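(* The natural map $H^{1}(\Gamma,G(\mathbb{C}))\to H^{1}(\Gamma,G(\widehat{K}))$ induces a bijection \[ H^{1}(\Gamma,G(\mathbb{C}))^{p\mathrm{-restricted}}\simeq H^{1}(\Gamma,G(\widehat{K})). \] Equivalently, any pair $(A,B)$ of matrices from $G(\widehat{K})$ satisfying the consistency condition $B(z/p)A(z)=A(z/q)B(z)$ can be reduced by a gauge transformation $(A,B)\mapsto(C(z/p)^{-1}A(z)C(z),\,C(z/q)^{-1}B(z)C(z))$ with $C\in G(\widehat{K})$ to a pair $(A_{0},B_{0})$ of matrices from $G(\mathbb{C})$, where $A_{0}$ is $p$-restricted, and such a pair $(A_{0},B_{0})$ is unique up to conjugation.
   Context: Let $p,q\ge2$ be multiplicatively independent natural numbers (i.e. $p^{n}q^{m}=1$ only for $n=m=0$). Let $\widehat{K}=\mathbb{C}((z))$, with the automorphisms $\sigma f(z)=f(z/p)$ and $\tau f(z)=f(z/q)$, and let $\Gamma=\langle\sigma,\tau\rangle$ (free abelian of rank 2). Let $G=GL_{r}$. The cohomology set $H^{1}(\Gamma,G(\widehat{K}))$ is the set of pairs $(A,B)$ of matrices in $G(\widehat{K})$ satisfying the consistency condition $B(z/p)A(z)=A(z/q)B(z)$, modulo gauge equivalence $(A,B)\sim(C(z/p)^{-1}A(z)C(z),\,C(z/q)^{-1}B(z)C(z))$, $C\in G(\widehat{K})$. Similarly $H^{1}(\Gamma,G(\mathbb{C}))$ is the set of commuting pairs $(A_0,B_0)$ of scalar matrices in $G(\mathbb{C})$ (i.e. homomorphisms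 $\varphi:\Gamma\to G(\mathbb{C})$), up to conjugation. A scalar matrix $A_{0}$ is called $p$-restricted if all its eigenvalues $c$ satisfy $1\le|c|<p$. $H^{1}(\Gamma,G(\mathbb{C}))^{p\mathrm{-restricted}}$ denotes the set of such homomorphisms $\varphi$ with $A_{0}=\varphi(\sigma)$ $p$-restricted, up to conjugation. *)

theory Defs
  imports Complex_Main "HOL-Computational_Algebra.Formal_Laurent_Series"
    "Jordan_Normal_Form.Matrix" "Jordan_Normal_Form.Char_Poly"
begin

text \<open>Khat = C((z)) is the type complex fls.  The substitution f(z) |-> f(z/c)
  acts on coefficients: the coefficient of z^n is multiplied by c^(-n).\<close>

lift_definition fls_subst_div :: "complex \<Rightarrow> complex fls \<Rightarrow> complex fls"
  is "\<lambda>c f n. (c powi (- n)) * f n"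
  by (erule MOST_mono) simp

definition mat_subst_div :: "nat \<Rightarrow> complex fls mat \<Rightarrow> complex fls mat" where
  "mat_subst_div c M = map_mat (fls_subst_div (of_nat c)) M"

definition const_mat :: "complex mat \<Rightarrow> complex fls mat" where
  "const_mat M = map_mat fls_const M"

definition GL :: "nat \<Rightarrow> 'a::comm_ring_1 mat set" where
  "GL r = {M. M \<in> carrier_mat r r \<and> invertible_mat M}"

definition mult_independent :: "nat \<Rightarrow> nat \<Rightarrow> bool" where
  "mult_independent p q \<longleftrightarrow>
     (\<forall>n m :: int. (real p) powi n * (real q) powi m = 1 \<longrightarrow> n = 0 \<and> m = 0)"

definition consistent_pair :: "nat \<Rightarrow> nat \<Rightarrow> nat \<Rightarrow> complex fls mat \<Rightarrow> complex fls mat \<Rightarrow> bool" where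
  "consistent_pair p q r A B \<longleftrightarrow> A \<in> GL r \<and> B \<in> GL r \<and>
     mat_subst_div p B * A = mat_subst_div q A * B"

text \<open>Gauge transformation by C: (A,B) |-> (C(z/p)^-1 A C, C(z/q)^-1 B C),
  expressed without the inverse: A' = C(z/p)^-1 A C iff C(z/p) A' = A C.\<close>
definition gauge_equiv :: "nat \<Rightarrow> nat \<Rightarrow> nat \<Rightarrow> complex fls mat \<Rightarrow> complex fls mat
     \<Rightarrow> complex fls mat \<Rightarrow> complex fls mat \<Rightarrow> bool" where
  "gauge_equiv p q r A B A' B' \<longleftrightarrow> (\<exists>C \<in> GL r.
     mat_subst_div p C * A' = A * C \<and> mat_subst_div q C * B' = B * C)"

text \<open>Homomorphism Gamma -> GL_r(C): a commuting pair of invertible scalar matrices.\<close>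
definition scalar_hom :: "nat \<Rightarrow> complex mat \<Rightarrow> complex mat \<Rightarrow> bool" where
  "scalar_hom r A0 B0 \<longleftrightarrow> A0 \<in> GL r \<and> B0 \<in> GL r \<and> A0 * B0 = B0 * A0"

definition conj_equiv :: "nat \<Rightarrow> complex mat \<Rightarrow> complex mat \<Rightarrow> complex mat \<Rightarrow> complex mat \<Rightarrow> bool" where
  "conj_equiv r A0 B0 A1 B1 \<longleftrightarrow> (\<exists>P \<in> GL r. P * A1 = A0 * P \<and> P * B1 = B0 * P)"

definition p_restricted :: "nat \<Rightarrow> complex mat \<Rightarrow> bool" where
  "p_restricted p A0 \<longleftrightarrow> (\<forall>c. eigenvalue A0 c \<longrightarrow> 1 \<le> cmod c \<and> cmod c < real p)"

end

theory Submission
  imports Defs "Jordan_Normal_Form.Schur_Decomposition"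
begin

text \<open>
  Let \<Phi> and \<Psi> be the commuting semilinear bijections v \<mapsto> \<sigma>^-1 (A v) and v \<mapsto> \<tau>^-1 (B v) of K^r.
  A minimal relation among the iterates \<Phi>^l v turns the search for an eigenvector
  \<Phi> w = y t^s w over a ramified extension t^m = z into a scalar equation; s/m is its least Newton
  slope, and the coefficients of a solution are found recursively once y comes from the root of
  largest modulus of the characteristic polynomial of that slope.  Then \<Psi>^l w is an
  eigenvector for y q^(ls/m) t^s, so in a minimal relation expressing \<Psi>^k w through the \<Psi>^l w a
  nonzero t^j coefficient at \<Psi>^l w forces p^(j/m) = q^((k-l)s/m).  Multiplicative independence
  gives s = 0 and j = 0: the relation has constant coefficients, hence \<Phi> and \<Psi> have a common
  eigenvector w.

  Multiplying w by a power of z makes its eigenvalue p-restricted.  Completing w to a basis and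
  inducting on r gives A constant and p-restricted: between restricted blocks, the equation for
  the coefficient of z^n of the off-diagonal part is resonant only for n = 0.  The same absence of
  resonances forces B, and any gauge transformation between two restricted constant pairs, to be
  constant.
\<close>

subsection \<open>Linear dependence and semilinear operators\<close>

text \<open>The ramified extension serves only to refute a nonzero slope: no vector found over
  C((t)) is descended to C((z)). Once s = 0, the slope conditions hold for the original relation
  over C((z)), and the scalar equation is solved there afresh. A single operator may well have
  nonzero slope; the second one is what excludes it.

  The root of largest modulus is chosen because the equation for the coefficient at t^N evaluates
  the characteristic polynomial at the root times p^(N/m). For N > 0 this point is larger in modulus
  than every root, so one can divide and the recursion never stalls.

  The annulus 1 \<le> |c| < p is a fundamental domain for multiplication by powers of p. Multiplying
  a vector by z^k moves an eigenvalue into it, and no two numbers inside it differ by a nontrivial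
  power of p; the absence of resonances is this second fact.

  The operators use inverse substitutions so that an eigenvector satisfies A w = y w(z/p), which is
  what the first column of a gauge matrix must satisfy in order to split off a constant
  entry.\<close>

definition lcomb :: "nat \<Rightarrow> (nat \<Rightarrow> 'k::field) \<Rightarrow> (nat \<Rightarrow> nat \<Rightarrow> 'k) \<Rightarrow> nat \<Rightarrow> 'k" where
  "lcomb k b u = (\<lambda>i. \<Sum>l<k. b l * u l i)"

definition indep :: "nat \<Rightarrow> (nat \<Rightarrow> nat \<Rightarrow> 'k::field) \<Rightarrow> bool" where
  "indep k u \<longleftrightarrow> (\<forall>b. lcomb k b u = (\<lambda>_. 0) \<longrightarrow> (\<forall>l<k. b l = 0))"

text \<open>Vectors of K^r are functions vanishing from index r on, so vector identities are
  equalities of functions. Quantifying over combinations of any length packs additivity and twisted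
  homogeneity into one law.\<close>

definition semilinear :: "('k::field \<Rightarrow> 'k) \<Rightarrow> ((nat \<Rightarrow> 'k) \<Rightarrow> nat \<Rightarrow> 'k) \<Rightarrow> bool" where
  "semilinear s F \<longleftrightarrow> (\<forall>k b u. F (lcomb k b u) = lcomb k (\<lambda>l. s (b l)) (\<lambda>l. F (u l)))"

lemma semilinearD:
  "semilinear s F \<Longrightarrow> F (lcomb k b u) = lcomb k (\<lambda>l. s (b l)) (\<lambda>l. F (u l))"
  by (simp add: semilinear_def)

lemma semilinear_scale:
  assumes "semilinear s F"
  shows "F (\<lambda>i. a * v i) = (\<lambda>i. s a * F v i)"
  using semilinearD[OF assms, of 1 "\<lambda>_. a" "\<lambda>_. v"] by (simp add: lcomb_def)

text \<open>The vanishing coordinate with index r pads r + 1 vectors to a square matrix with a zero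
  row. Its determinant is zero, and a kernel vector lists the coefficients of a relation.\<close>

lemma dependent_family:
  fixes u :: "nat \<Rightarrow> nat \<Rightarrow> 'k::field"
  assumes supp: "\<And>l i. r \<le> i \<Longrightarrow> u l i = 0"
  shows "\<not> indep (Suc r) u"
proof -
  define M where "M = mat (Suc r) (Suc r) (\<lambda>(i,l). u l i)"
  have M: "M \<in> carrier_mat (Suc r) (Suc r)" by (simp add: M_def)
  have "row M r = 0\<^sub>v (Suc r)"
    using supp by (auto simp: M_def)
  hence "det (transpose_mat M) = 0"
    using det_0_iff_vec_prod_zero[of M "Suc r"] M
    by (subst laplace_expansion_column[of _ "Suc r" r]) (auto simp: supp M_def)
  hence "det M = 0" using M by (simp add: det_transpose)
  then obtain v where v: "v \<in> carrier_vec (Suc r)" "v \<noteq> 0\<^sub>v (Suc r)" "M *\<^sub>v v = 0\<^sub>v (Suc r)"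
    using det_0_iff_vec_prod_zero[OF M] by auto
  have "lcomb (Suc r) (\<lambda>l. v $ l) u i = 0" for i
  proof (cases "i < Suc r")
    case True
    have "(M *\<^sub>v v) $ i = 0" using v True by simp
    thus ?thesis using True v(1)
      by (simp add: M_def lcomb_def scalar_prod_def atLeast0LessThan mult.commute row_def)
  next
    case False
    thus ?thesis by (simp add: lcomb_def supp)
  qed
  moreover obtain l where "l < Suc r" "v $ l \<noteq> 0"
    using v(1,2) by (metis carrier_vecD eq_vecI index_zero_vec(1) index_zero_vec(2))
  ultimately show ?thesis unfolding indep_def by blast
qed

text \<open>Take the shortest dependent initial segment. The nonzero start forces its length to be
  at least 2, and minimality keeps the last coefficient nonzero, so the relation can be solved for
  the last vector.\<close>

lemma minimal_relation:
  fixes u :: "nat \<Rightarrow> nat \<Rightarrow> 'k::field"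
  assumes supp: "\<And>l i. r \<le> i \<Longrightarrow> u l i = 0" and u0: "u 0 \<noteq> (\<lambda>_. 0)"
  obtains n a where "indep (Suc n) u" "u (Suc n) = lcomb (Suc n) a u"
proof -
  define k where "k = (LEAST k. \<not> indep k u)"
  have dep: "\<not> indep k u" unfolding k_def
    using dependent_family[of r u, OF supp] by (rule LeastI)
  have ind: "indep j u" if "j < k" for j
    using not_less_Least[of j "\<lambda>k. \<not> indep k u"] that unfolding k_def by auto
  have i0: "indep 0 u" by (simp add: indep_def)
  have i1: "indep 1 u" using u0 by (auto simp: indep_def lcomb_def fun_eq_iff)
  have "k \<noteq> 0" "k \<noteq> 1" using dep i0 i1 by metis+
  then obtain n where n: "k = Suc (Suc n)"
    by (metis One_nat_def not0_implies_Suc)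
  have indn: "indep (Suc n) u" using ind n by simp
  obtain b where b: "lcomb k b u = (\<lambda>_. 0)" "\<exists>l<k. b l \<noteq> 0"
    using dep unfolding indep_def by blast
  have eq: "lcomb (Suc n) b u i + b (Suc n) * u (Suc n) i = 0" for i
    using fun_cong[OF b(1), of i] by (simp add: n lcomb_def)
  have bn: "b (Suc n) \<noteq> 0"
  proof
    assume z: "b (Suc n) = 0"
    hence "lcomb (Suc n) b u = (\<lambda>_. 0)" using eq by auto
    hence "\<forall>l<Suc n. b l = 0" using indn unfolding indep_def by blast
    thus False using b(2) z n less_Suc_eq by auto
  qed
  have "u (Suc n) i = lcomb (Suc n) (\<lambda>l. - b l / b (Suc n)) u i" for i
  proof -
    have "u (Suc n) i = - lcomb (Suc n) b u i / b (Suc n)"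
      using eq[of i] bn by (simp add: field_simps add_eq_0_iff)
    also have "\<dots> = lcomb (Suc n) (\<lambda>l. - b l / b (Suc n)) u i"
      unfolding lcomb_def sum_negf[symmetric] sum_divide_distrib
      by (rule sum.cong) simp_all
    finally show ?thesis .
  qed
  thus thesis using indn that by blast
qed

lemma indepD:
  assumes "indep n u" "lcomb n a u = lcomb n b u" "l < n"
  shows "a l = b l"
proof -
  have "lcomb n (\<lambda>l. a l - b l) u = (\<lambda>_. 0)"
    using fun_cong[OF assms(2)] by (auto simp: lcomb_def left_diff_distrib sum_subtractf fun_eq_iff)
  thus ?thesis using assms unfolding indep_def by fastforce
qed

text \<open>The condition on \<open>b\<close> is the twisted eigenvector equation of a companion
  matrix: \<open>F\<close> shifts the family \<open>u\<close>, and the relation folds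
  \<open>u (Suc n)\<close> back onto the earlier vectors.\<close>

lemma eigenvector_of_relation:
  assumes F: "semilinear s F" and step: "\<And>l. u (Suc l) = F (u l)"
    and rel: "u (Suc n) = lcomb (Suc n) a u"
    and b: "\<And>l. l \<le> n \<Longrightarrow> f * b l = (if l = 0 then 0 else s (b (l - 1))) + s (b n) * a l"
  shows "F (lcomb (Suc n) b u) = (\<lambda>i. f * lcomb (Suc n) b u i)"
proof
  fix i
  have "F (lcomb (Suc n) b u) i = (\<Sum>l<Suc n. s (b l) * u (Suc l) i)"
    by (simp only: semilinearD[OF F]) (simp add: lcomb_def step)
  also have "\<dots> = (\<Sum>l<n. s (b l) * u (Suc l) i) + s (b n) * lcomb (Suc n) a u i"
    by (simp add: rel)
  also have "(\<Sum>l<n. s (b l) * u (Suc l) i)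
      = (\<Sum>l<Suc n. (if l = 0 then 0 else s (b (l - 1))) * u l i)"
    by (subst sum.lessThan_Suc_shift) simp
  also have "s (b n) * lcomb (Suc n) a u i = (\<Sum>l<Suc n. s (b n) * a l * u l i)"
    by (simp add: lcomb_def sum_distrib_left distrib_left mult.assoc)
  also have "(\<Sum>l<Suc n. (if l = 0 then 0 else s (b (l - 1))) * u l i) + \<dots>
      = (\<Sum>l<Suc n. ((if l = 0 then 0 else s (b (l - 1))) + s (b n) * a l) * u l i)"
    by (simp only: sum.distrib[symmetric] distrib_right)
  also have "\<dots> = (\<Sum>l<Suc n. f * b l * u l i)"
    by (rule sum.cong) (simp_all add: b)
  also have "\<dots> = f * lcomb (Suc n) b u i"
    by (simp add: lcomb_def sum_distrib_left distrib_left mult.assoc)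
  finally show "F (lcomb (Suc n) b u) i = f * lcomb (Suc n) b u i" .
qed

subsection \<open>The substitution on Laurent series\<close>

notation fls_nth (infixl \<open>$\<^sub>z\<close> 75)

lemma fls_subst_div_nth: "fls_subst_div c f $\<^sub>z n = c powi (- n) * f $\<^sub>z n"
  by (simp add: fls_subst_div.rep_eq)

lemma fls_subst_div_add: "fls_subst_div c (f + g) = fls_subst_div c f + fls_subst_div c g"
  by (rule fls_eqI) (simp add: fls_subst_div_nth distrib_left)

lemma fls_subst_div_zero [simp]: "fls_subst_div c 0 = 0"
  by (rule fls_eqI) (simp add: fls_subst_div_nth)

lemma fls_subst_div_const [simp]: "fls_subst_div c (fls_const a) = fls_const a"
  by (rule fls_eqI) (simp add: fls_subst_div_nth)

lemma fls_subst_div_of_1 [simp]: "fls_subst_div c 1 = 1"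
  using fls_subst_div_const[of c 1] by (simp del: fls_subst_div_const)

lemma fls_subst_div_by_1 [simp]: "fls_subst_div 1 f = f"
  by (rule fls_eqI) (simp add: fls_subst_div_nth)

lemma fls_subst_div_compose: "fls_subst_div c (fls_subst_div d f) = fls_subst_div (c * d) f"
  by (rule fls_eqI) (simp add: fls_subst_div_nth power_int_mult_distrib)

lemma fls_subst_div_sum: "fls_subst_div c (\<Sum>i\<in>I. f i) = (\<Sum>i\<in>I. fls_subst_div c (f i))"
  by (induction I rule: infinite_finite_induct) (simp_all add: fls_subst_div_add)

lemma fls_subst_div_eq_0_iff:
  "c \<noteq> 0 \<Longrightarrow> fls_subst_div c f = 0 \<longleftrightarrow> f = 0"
  by (auto simp: fls_eq_iff fls_subst_div_nth)

lemma fls_subdegree_subst_div: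
  assumes "c \<noteq> 0"
  shows "fls_subdegree (fls_subst_div c f) = fls_subdegree f"
proof (cases "f = 0")
  case False
  show ?thesis
    by (rule fls_subdegree_eqI) (use False assms in \<open>auto simp: fls_subst_div_nth\<close>)
qed simp

text \<open>The substitution preserves subdegrees, so both convolutions run over the same index
  range and agree term by term.\<close>

lemma fls_subst_div_mult:
  assumes "c \<noteq> 0"
  shows "fls_subst_div c (f * g) = fls_subst_div c f * fls_subst_div c g"
proof (rule fls_eqI)
  fix n
  have "c powi (-i) * f $\<^sub>z i * (c powi (-(n - i)) * g $\<^sub>z (n - i)) = c powi (-n) * (f $\<^sub>z i * g $\<^sub>z (n - i))" for i
  proof -
    have "c powi (-n) = c powi (-i) * c powi (-(n - i))"
      using assms by (simp add: power_int_add[symmetric])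
    thus ?thesis by (simp add: mult_ac)
  qed
  thus "fls_subst_div c (f * g) $\<^sub>z n = (fls_subst_div c f * fls_subst_div c g) $\<^sub>z n"
    by (simp only: fls_subst_div_nth fls_times_nth(2) fls_subdegree_subst_div[OF assms] sum_distrib_left)
qed

lemma fls_subst_div_X_intpow:
  "fls_subst_div c (fls_X_intpow s) = fls_const (c powi (- s)) * fls_X_intpow s"
  by (rule fls_eqI) (simp add: fls_subst_div_nth)

lemma fls_const_times_nth: "(fls_const a * f) $\<^sub>z n = a * f $\<^sub>z n" for f :: "complex fls"
  by simp

text \<open>With t^m = z, the substitution of t/P for t extends that of z/p for z because P^m = p.
  This carries the two automorphisms to C((t)).\<close>

lemma fls_subst_div_compose_power:
  assumes "P ^ m = p" "m > 0" "P \<noteq> 0"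
  shows "fls_subst_div P (fls_compose_power f m) = fls_compose_power (fls_subst_div p f) m"
proof (rule fls_eqI)
  fix n
  show "fls_subst_div P (fls_compose_power f m) $\<^sub>z n = fls_compose_power (fls_subst_div p f) m $\<^sub>z n"
  proof (cases "int m dvd n")
    case True
    then obtain k where k: "n = int m * k" by blast
    have "P powi (- n) = p powi (- k)"
      using assms(1) by (simp add: k power_int_mult flip: power_int_of_nat mult_minus_right)
    thus ?thesis using assms by (simp add: fls_subst_div_nth fls_nth_compose_power k)
  qed (use assms in \<open>simp add: fls_subst_div_nth fls_nth_compose_power\<close>)
qed

lemma fls_subdegree_compose_power:
  assumes "m > 0"
  shows "fls_subdegree (fls_compose_power f m) = int m * fls_subdegree f"
proof (cases "f = 0")
  case False
  show ?thesis
  proof (rule fls_subdegree_eqI)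
    show "fls_compose_power f m $\<^sub>z (int m * fls_subdegree f) \<noteq> 0"
      using False assms by (simp add: fls_nth_compose_power)
    fix k assume k: "k < int m * fls_subdegree f"
    show "fls_compose_power f m $\<^sub>z k = 0"
    proof (cases "int m dvd k")
      case True
      then obtain j where "k = int m * j" by blast
      with k assms show ?thesis by (simp add: fls_nth_compose_power mult_less_cancel_left)
    qed (use assms in \<open>simp add: fls_nth_compose_power\<close>)
  qed
qed simp

lemma fls_compose_power_eq_0_iff:
  assumes "m > 0"
  shows "fls_compose_power f m = 0 \<longleftrightarrow> f = 0"
proof
  assume z: "fls_compose_power f m = 0"
  show "f = 0"
  proof (rule fls_eqI)
    fix n
    have "f $\<^sub>z n = fls_compose_power f m $\<^sub>z (int m * n)"
      using assms by (simp add: fls_nth_compose_power)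
    thus "f $\<^sub>z n = 0 $\<^sub>z n" by (simp add: z)
  qed
qed simp

section \<open>Power series solutions of the scalar equation\<close>

fun linrec :: "(nat \<Rightarrow> nat \<Rightarrow> 'a::semiring_1) \<Rightarrow> nat \<Rightarrow> 'a" where
  "linrec e n = (if n = 0 then 1 else \<Sum>i\<in>{1..n}. e n i * linrec e (n - i))"

declare linrec.simps [simp del]

text \<open>The polynomial 1 - \<Sum> g_j X^(j+1) is nonconstant, so its finite root set is nonempty
  and has a member of largest modulus; the constant term 1 keeps 0 out of it.\<close>

lemma extremal_root:
  fixes g :: "nat \<Rightarrow> complex"
  assumes "j0 \<le> n" "g j0 \<noteq> 0"
  obtains x where "x \<noteq> 0" "(\<Sum>j\<le>n. g j * x ^ Suc j) = 1"
    "\<And>y. cmod x < cmod y \<Longrightarrow> (\<Sum>j\<le>n. g j * y ^ Suc j) \<noteq> 1"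
proof -
  define \<chi> where "\<chi> = 1 - (\<Sum>j\<le>n. Polynomial.monom (g j) (Suc j))"
  have ev: "poly \<chi> y = 1 - (\<Sum>j\<le>n. g j * y ^ Suc j)" for y
    by (simp add: \<chi>_def poly_sum poly_monom)
  have "coeff (\<Sum>j\<le>n. Polynomial.monom (g j) (Suc j)) (Suc j0) = (\<Sum>j\<le>n. if j = j0 then g j else 0)"
    unfolding coeff_sum by (rule sum.cong) auto
  hence cf: "coeff \<chi> (Suc j0) = - g j0"
    using assms(1) by (simp add: \<chi>_def)
  hence deg: "degree \<chi> \<noteq> 0" using assms(2) by (metis coeff_eq_0 neg_equal_0_iff_equal zero_less_Suc neq0_conv)
  hence nz: "\<chi> \<noteq> 0" by auto
  have "\<not> constant (poly \<chi>)" using deg by (simp add: constant_degree)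
  then obtain z where z: "poly \<chi> z = 0" using fundamental_theorem_of_algebra by blast
  define R where "R = {z. poly \<chi> z = 0}"
  have fin: "finite R" unfolding R_def by (rule poly_roots_finite[OF nz])
  have "R \<noteq> {}" using z by (auto simp: R_def)
  hence "Max (cmod ` R) \<in> cmod ` R" using fin by simp
  then obtain x where "x \<in> R" "Max (cmod ` R) = cmod x" by blast
  hence x: "x \<in> R" "\<And>y. y \<in> R \<Longrightarrow> cmod y \<le> cmod x"
    using fin by (auto intro!: Max_ge[of "cmod ` R"] simp flip: \<open>Max (cmod ` R) = cmod x\<close>)
  show thesis
  proof (rule that)
    show eq: "(\<Sum>j\<le>n. g j * x ^ Suc j) = 1" using x(1) ev[of x] by (simp add: R_def)
    show "x \<noteq> 0" using eq by (intro notI) simp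
    fix y assume "cmod x < cmod y"
    hence "y \<notin> R" using x(2)[of y] by auto
    thus "(\<Sum>j\<le>n. g j * y ^ Suc j) \<noteq> 1" using ev[of y] by (simp add: R_def)
  qed
qed

lemma fls_subst_div_fps_to_fls:
  "fls_subst_div c (fps_to_fls g) = fps_to_fls (Abs_fps (\<lambda>n. (1 / c) ^ n * fps_nth g n))"
  by (rule fls_eqI) (simp add: fls_subst_div_nth power_int_def power_divide divide_simps)

text \<open>Let \<chi> = 1 - \<Sum> g_j(0) X^(j+1). The coefficient at N of the equation expresses
  \<chi>(x w^N) b_N through b_0, ..., b_(N-1). For N = 0 it reads \<chi>(x) = 0, which leaves b_0
  free; for N > 0 the factor is nonzero because x w^N lies outside the circle containing all
  roots.\<close>

lemma integral_equation:
  fixes g :: "nat \<Rightarrow> complex fps"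
  assumes "j0 \<le> n" "fps_nth (g j0) 0 \<noteq> 0" and c: "c \<noteq> 0" "cmod c < 1"
  obtains x \<beta> where "x \<noteq> 0" "\<beta> \<noteq> 0"
    "\<beta> = (\<Sum>j\<le>n. fls_const (x ^ Suc j) * fps_to_fls (g j) * fls_subst_div (c ^ Suc j) \<beta>)"
proof -
  define w where "w = 1 / c"
  have w: "cmod w > 1" using c by (simp add: w_def norm_divide)
  obtain x where x: "x \<noteq> 0" "(\<Sum>j\<le>n. fps_nth (g j) 0 * x ^ Suc j) = 1"
    "\<And>y. cmod x < cmod y \<Longrightarrow> (\<Sum>j\<le>n. fps_nth (g j) 0 * y ^ Suc j) \<noteq> 1"
    using extremal_root[of j0 n "\<lambda>j. fps_nth (g j) 0"] assms by metis
  define D where "D N = 1 - (\<Sum>j\<le>n. fps_nth (g j) 0 * (x * w ^ N) ^ Suc j)" for N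
  have D: "D N \<noteq> 0" if "N > 0" for N
  proof -
    have "cmod x < cmod (x * w ^ N)"
      using x(1) one_less_power[OF w that] by (simp add: norm_mult norm_power)
    from x(3)[OF this] show ?thesis by (simp add: D_def)
  qed
  \<comment> \<open>\<open>D 0\<close> is zero, but \<open>linrec\<close> starts with the value 1
    and reads \<open>e N\<close> only for N > 0.\<close>
  define e where "e N i = (\<Sum>j\<le>n. x ^ Suc j * fps_nth (g j) i * (w ^ Suc j) ^ (N - i)) / D N" for N i
  define b where "b = Abs_fps (linrec e)"
  have b0: "fps_nth b 0 = 1" by (simp add: b_def linrec.simps)
  define rhs where "rhs = (\<Sum>j\<le>n. fps_const (x ^ Suc j) * g j * Abs_fps (\<lambda>N. (w ^ Suc j) ^ N * fps_nth b N))"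
  have rhs: "fps_nth rhs N = (\<Sum>i=0..N. (\<Sum>j\<le>n. x ^ Suc j * fps_nth (g j) i * (w ^ Suc j) ^ (N - i)) * fps_nth b (N - i))" for N
    unfolding rhs_def fps_sum_nth mult.assoc fps_mult_left_const_nth
    by (simp add: fps_mult_nth sum_distrib_left sum_distrib_right mult_ac)
      (rule sum.swap)
  have "fps_nth b N = fps_nth rhs N" for N
  proof (cases "N = 0")
    case True
    thus ?thesis using x(2) by (simp add: rhs b0 mult_ac)
  next
    case False
    have "D N * fps_nth b N = D N * (\<Sum>i\<in>{1..N}. e N i * fps_nth b (N - i))"
      using False unfolding b_def by (simp add: linrec.simps[of e N])
    also have "\<dots> = (\<Sum>i\<in>{1..N}. (\<Sum>j\<le>n. x ^ Suc j * fps_nth (g j) i * (w ^ Suc j) ^ (N - i)) * fps_nth b (N - i))"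
      unfolding sum_distrib_left using D[of N] False by (intro sum.cong) (simp_all add: e_def)
    \<comment> \<open>The term \<open>i = 0\<close> is the one containing \<open>fps_nth b N\<close>
      itself; its factor is 1 - \<open>D N\<close>.\<close>
    also have "\<dots> = fps_nth rhs N - (\<Sum>j\<le>n. x ^ Suc j * fps_nth (g j) 0 * (w ^ Suc j) ^ N) * fps_nth b N"
      by (simp add: rhs sum.atLeast_Suc_atMost)
    also have "(\<Sum>j\<le>n. x ^ Suc j * fps_nth (g j) 0 * (w ^ Suc j) ^ N) = 1 - D N"
      by (simp add: D_def power_mult_distrib mult_ac flip: power_mult)
    finally show ?thesis by (simp add: algebra_simps)
  qed
  hence "b = rhs" by (rule fps_ext)
  hence eq: "fps_to_fls b = fps_to_fls rhs" by simp
  have "fps_to_fls rhs = (\<Sum>j\<le>n. fls_const (x ^ Suc j) * fps_to_fls (g j) * fls_subst_div (c ^ Suc j) (fps_to_fls b))"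
    unfolding rhs_def fls_subst_div_fps_to_fls
    by (simp add: fls_times_fps_to_fls w_def power_divide flip: fps_const_to_fls)
       (induction n; simp add: fls_times_fps_to_fls)
  moreover have "fps_to_fls b \<noteq> 0" using b0 by (metis fps_to_fls_eq_0_iff fps_zero_nth zero_neq_one)
  ultimately show thesis using that[of x "fps_to_fls b"] x(1) eq by simp
qed

subsection \<open>The scalar equation attached to a cyclic vector\<close>

text \<open>The product of t^(-s) with its first j twists, which accumulates when b_l = x t^(-s)
  (...) is unrolled j times. What counts later is its order -s (j + 1).\<close>

fun twist :: "complex \<Rightarrow> int \<Rightarrow> nat \<Rightarrow> complex fls" where
  "twist c s 0 = fls_X_intpow (- s)"
| "twist c s (Suc j) = fls_X_intpow (- s) * fls_subst_div c (twist c s j)"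

lemma twist:
  assumes "c \<noteq> 0"
  shows "twist c s j \<noteq> 0 \<and> fls_subdegree (twist c s j) = - s * int (Suc j)"
proof (induction j)
  case (Suc j)
  thus ?case
    using assms
    by (simp add: fls_X_intpow_times_conv_shift fls_shift_eq0_iff fls_subst_div_eq_0_iff
        fls_subdegree_subst_div algebra_simps del: fls_shifted_times_simps)
qed (simp add: fls_shift_eq0_iff)

text \<open>
  Eliminating b 0, ..., b (n - 1) leaves one equation for b n.  The slope conditions say that its
  coefficients are integral and that one of them is a unit.
\<close>

lemma scalar_equation:
  fixes a :: "nat \<Rightarrow> complex fls"
  assumes c: "c \<noteq> 0" "cmod c < 1"
    and slope: "\<And>l. l \<le> n \<Longrightarrow> a l \<noteq> 0 \<Longrightarrow> int (Suc n - l) * s \<le> fls_subdegree (a l)"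
    and l0: "l0 \<le> n" "a l0 \<noteq> 0" "int (Suc n - l0) * s = fls_subdegree (a l0)"
  obtains y b where "y \<noteq> 0" "b n \<noteq> 0"
    "\<And>l. l \<le> n \<Longrightarrow> fls_const y * fls_X_intpow s * b l
       = (if l = 0 then 0 else fls_subst_div c (b (l - 1))) + fls_subst_div c (b n) * a l"
proof -
  define S where "S j = fls_subst_div (c ^ j)" for j
  \<comment> \<open>These are the coefficients of the equation for \<open>b n\<close>. The order of
    a nonzero \<open>h j\<close> is that of \<open>a (n - j)\<close> minus s (j + 1), hence
    nonnegative by \<open>slope\<close>, and it is 0 for \<open>j = n - l0\<close>.\<close>
  define h where "h j = twist c s j * S j (a (n - j))" for j
  have cj: "c ^ j \<noteq> 0" for j using c by simp
  have sdh: "fls_subdegree (h j) = fls_subdegree (a (n - j)) - s * int (Suc j)" "h j \<noteq> 0"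
    if "a (n - j) \<noteq> 0" for j
    using that twist[OF c(1), of s j]
    by (simp_all add: h_def S_def fls_subst_div_eq_0_iff[OF cj] fls_subdegree_subst_div[OF cj])
  have reg: "h j = fps_to_fls (fls_regpart (h j))" if "j \<le> n" for j
  proof -
    have "fls_subdegree (h j) \<ge> 0"
    proof (cases "a (n - j) = 0")
      case True thus ?thesis by (simp add: h_def S_def)
    next
      case False
      have "Suc n - (n - j) = Suc j" using that by simp
      thus ?thesis using sdh[OF False] slope[of "n - j"] False by (simp add: mult.commute)
    qed
    thus ?thesis by (simp add: fls_regpart_to_fls_trivial)
  qed
  define j0 where "j0 = n - l0"
  have j0: "j0 \<le> n" "n - j0 = l0" "Suc n - l0 = Suc j0" using l0(1) by (auto simp: j0_def)
  have "fls_subdegree (h j0) = 0"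
    using sdh(1)[of j0] l0(2,3) unfolding j0 by (simp add: mult.commute)
  moreover have "h j0 \<noteq> 0" using sdh(2)[of j0] l0(2) j0 by simp
  ultimately have "fps_nth (fls_regpart (h j0)) 0 \<noteq> 0"
    using nth_fls_subdegree_nonzero[of "h j0"] by simp
  from integral_equation[of j0 n "\<lambda>j. fls_regpart (h j)", OF j0(1) this c] obtain x \<beta> where x: "x \<noteq> 0" and \<beta>: "\<beta> \<noteq> 0"
    "\<beta> = (\<Sum>j\<le>n. fls_const (x ^ Suc j) * fps_to_fls (fls_regpart (h j)) * fls_subst_div (c ^ Suc j) \<beta>)"
    by blast
  \<comment> \<open>The recursion unrolled down to index 0, with \<open>\<beta>\<close> standing for
    \<open>b n\<close> and \<open>x\<close> for the inverse of \<open>y\<close>. The equation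
    satisfied by \<open>\<beta>\<close> then yields \<open>b n = \<beta>\<close>, which closes the
    loop.\<close>
  define b where "b l = (\<Sum>j\<le>l. fls_const (x ^ Suc j) * twist c s j * S j (a (l - j)) * S (Suc j) \<beta>)" for l
  have bn: "b n = \<beta>"
  proof -
    have "b n = (\<Sum>j\<le>n. fls_const (x ^ Suc j) * h j * fls_subst_div (c ^ Suc j) \<beta>)"
      by (simp only: b_def h_def S_def mult.assoc)
    also have "\<dots> = \<beta>"
      by (rule trans[OF _ \<beta>(2)[symmetric]], rule sum.cong[OF refl])
        (rule arg_cong2[where f = "(*)", OF arg_cong2[where f = "(*)", OF refl reg] refl], simp)
    finally show ?thesis .
  qed
  have S1: "fls_subst_div c (S j g) = S (Suc j) g" for j g
    by (simp add: S_def fls_subst_div_compose)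
  have S0: "S 0 g = g" "S (Suc 0) g = fls_subst_div c g" for g by (simp_all add: S_def)
  have pw: "fls_const (x ^ Suc k) = fls_const x * fls_const (x ^ k)" for k
    by (simp add: fls_const_mult_const)
  have rec: "b l = fls_const x * fls_X_intpow (- s)
      * ((if l = 0 then 0 else fls_subst_div c (b (l - 1))) + fls_subst_div c (b n) * a l)" for l
  proof (cases l)
    case 0
    have "b 0 = fls_const x * twist c s 0 * S 0 (a 0) * S (Suc 0) \<beta>" by (simp add: b_def)
    thus ?thesis
      by (simp only: 0 S0 bn twist.simps simp_thms if_True add_0 mult_ac)
  next
    case (Suc l')
    have "b l = fls_const x * twist c s 0 * a l * S 1 \<beta>
        + (\<Sum>j\<le>l'. fls_const (x ^ Suc (Suc j)) * twist c s (Suc j) * S (Suc j) (a (l' - j)) * S (Suc (Suc j)) \<beta>)"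
      unfolding b_def Suc by (subst sum.atMost_Suc_shift) (simp add: S0)
    also have "(\<Sum>j\<le>l'. fls_const (x ^ Suc (Suc j)) * twist c s (Suc j) * S (Suc j) (a (l' - j)) * S (Suc (Suc j)) \<beta>)
        = fls_const x * fls_X_intpow (- s) * fls_subst_div c (b l')"
      unfolding b_def fls_subst_div_sum sum_distrib_left fls_subst_div_mult[OF c(1)] S1 fls_subst_div_const
      by (intro sum.cong) (simp_all only: pw twist.simps mult_ac)
    finally show ?thesis
      by (simp only: Suc bn S0 One_nat_def twist.simps nat.simps if_False diff_Suc_Suc diff_zero distrib_left mult_ac add_ac)
  qed
  have inv: "fls_const (1 / x) * fls_X_intpow s * (fls_const x * fls_X_intpow (- s) * g) = g" for g
  proof -
    have "fls_const (1 / x) * fls_const x = (1 :: complex fls)" using x by (simp add: fls_const_mult_const)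
    moreover have "fls_X_intpow s * fls_X_intpow (- s) = (1 :: complex fls)"
      by (simp only: fls_X_intpow_times_fls_X_intpow) simp
    ultimately show ?thesis by (metis (no_types) mult.assoc mult.left_commute mult.left_neutral)
  qed
  show thesis
  proof (rule that)
    show "1 / x \<noteq> 0" using x by simp
    show "b n \<noteq> 0" using \<beta> bn by simp
    fix l
    show "fls_const (1 / x) * fls_X_intpow s * b l
       = (if l = 0 then 0 else fls_subst_div c (b (l - 1))) + fls_subst_div c (b n) * a l"
      by (subst rec) (rule inv)
  qed
qed

text \<open>The index minimises the quotient of the order of \<open>a l\<close> by
  \<open>Suc n - l\<close>. The inequality is cross-multiplied to stay integral: it is the slope
  condition of the scalar equation once ramification has multiplied all orders by
  \<open>Suc n - l0\<close>.\<close>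

lemma minimal_slope:
  fixes a :: "nat \<Rightarrow> complex fls"
  assumes "\<exists>l\<le>n. a l \<noteq> 0"
  obtains l0 where "l0 \<le> n" "a l0 \<noteq> 0"
    "\<And>l. l \<le> n \<Longrightarrow> a l \<noteq> 0 \<Longrightarrow>
      int (Suc n - l) * fls_subdegree (a l0) \<le> int (Suc n - l0) * fls_subdegree (a l)"
proof -
  define T where "T = {l. l \<le> n \<and> a l \<noteq> 0}"
  define v where "v l = real_of_int (fls_subdegree (a l)) / real (Suc n - l)" for l
  have T: "finite T" "T \<noteq> {}" using assms by (auto simp: T_def)
  hence "Min (v ` T) \<in> v ` T" by simp
  then obtain l0 where l0: "l0 \<in> T" "Min (v ` T) = v l0" by blast
  hence min: "v l0 \<le> v l" if "l \<in> T" for l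
    using T(1) that by (auto intro!: Min_le[of "v ` T"] simp flip: l0(2))
  show thesis
  proof (rule that)
    fix l assume l: "l \<le> n" "a l \<noteq> 0"
    hence "v l0 \<le> v l" using min by (simp add: T_def)
    hence "real (Suc n - l) * real_of_int (fls_subdegree (a l0)) \<le> real (Suc n - l0) * real_of_int (fls_subdegree (a l))"
    proof -
      have "0 < real (Suc n - l)" "0 < real (Suc n - l0)" using l l0(1) by (auto simp: T_def)
      thus ?thesis using \<open>v l0 \<le> v l\<close> unfolding v_def
        by (simp only: pos_divide_le_eq pos_le_divide_eq times_divide_eq_left) (simp only: mult.commute)
    qed
    hence "real_of_int (int (Suc n - l) * fls_subdegree (a l0)) \<le> real_of_int (int (Suc n - l0) * fls_subdegree (a l))"
      by simp
    thus "int (Suc n - l) * fls_subdegree (a l0) \<le> int (Suc n - l0) * fls_subdegree (a l)"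
      by (simp only: of_int_le_iff)
  qed (use l0 in \<open>auto simp: T_def\<close>)
qed

subsection \<open>Ramified extensions\<close>

text \<open>Padding the index range with zero terms lets two convolutions with different supports be
  compared over matching ranges.\<close>

lemma fls_times_nth_bounds:
  fixes f g :: "'a::comm_ring_1 fls"
  assumes "L \<le> fls_subdegree g" "N - fls_subdegree f \<le> U"
  shows "(g * f) $\<^sub>z N = (\<Sum>i=L..U. g $\<^sub>z i * f $\<^sub>z (N - i))"
  unfolding fls_times_nth(2) using assms
  by (intro sum.mono_neutral_left) auto

text \<open>
  For t^m = z this is the component along t^e of an element of C((t)) over C((z)).  Being
  C((z))-linear, it shows that linear independence survives the ramified extension.
\<close>

lift_definition fls_section :: "nat \<Rightarrow> int \<Rightarrow> 'a::zero fls \<Rightarrow> 'a fls"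
  is "\<lambda>m e f n. if m = 0 then 0 else f (int m * n + e)"
proof -
  fix m :: nat and e :: int and f :: "int \<Rightarrow> 'a"
  assume "\<forall>\<^sub>\<infinity>n. f (- int n) = 0"
  then obtain M where M: "\<And>n. n > M \<Longrightarrow> f (- int n) = 0" by (auto simp: MOST_nat)
  show "\<forall>\<^sub>\<infinity>n. (if m = 0 then 0 else f (int m * - int n + e)) = 0"
    unfolding MOST_nat
  proof (intro exI allI impI)
    fix n assume n: "n > M + nat \<bar>e\<bar>"
    show "(if m = 0 then 0 else f (int m * - int n + e)) = 0"
    proof (cases "m = 0")
      case False
      have "int n \<le> int m * int n" using False by (simp add: mult_le_cancel_right1)
      hence "int M < int m * int n - e" using n by linarith
      hence "f (- int (nat (int m * int n - e))) = 0" by (intro M) linarith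
      moreover have "- int (nat (int m * int n - e)) = int m * - int n + e"
        using \<open>int M < int m * int n - e\<close> by simp
      ultimately show ?thesis by simp
    qed simp
  qed
qed

lemma fls_section_nth:
  "m > 0 \<Longrightarrow> fls_section m e f $\<^sub>z n = f $\<^sub>z (int m * n + e)"
  by (simp add: fls_section.rep_eq)

lemma fls_section_sum:
  assumes "m > 0"
  shows "fls_section m e (\<Sum>l\<in>I. f l) = (\<Sum>l\<in>I. fls_section m e (f l))"
proof -
  have add: "fls_section m e (f + g) = fls_section m e f + fls_section m e g" for f g :: "'a fls"
    by (rule fls_eqI) (simp add: fls_section_nth[OF assms])
  have zero: "fls_section m e 0 = (0 :: 'a fls)"
    by (rule fls_eqI) (simp add: fls_section_nth[OF assms])
  show ?thesis by (induction I rule: infinite_finite_induct) (simp_all add: add zero)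
qed

lemma fls_section_mult_compose_power:
  fixes f g :: "'a::field fls"
  assumes m: "m > 0"
  shows "fls_section m e (f * fls_compose_power g m) = fls_section m e f * g"
proof (rule fls_eqI)
  fix j
  define L where "L = fls_subdegree g"
  \<comment> \<open>One bound must serve both convolutions: \<open>U\<close> downstairs and
    \<open>m * U\<close> upstairs. The second entry makes \<open>U\<close> nonnegative, so that
    \<open>U\<close> does not exceed \<open>m * U\<close>, and it dominates the upstairs
    range.\<close>
  define U where "U = max (j - fls_subdegree (fls_section m e f)) (int m * \<bar>j\<bar> + \<bar>e\<bar> + \<bar>fls_subdegree f\<bar>)"
  have mU: "int m * j + e - fls_subdegree f \<le> int m * U"
  proof -
    have "0 \<le> int m * \<bar>j\<bar> + \<bar>e\<bar> + \<bar>fls_subdegree f\<bar>" by simp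
    hence U0: "0 \<le> U" unfolding U_def by (simp only: le_max_iff_disj simp_thms)
    have "int m * j \<le> int m * \<bar>j\<bar>" by (intro mult_left_mono) auto
    hence "int m * j + e - fls_subdegree f \<le> U" unfolding U_def by linarith
    also have "U \<le> int m * U" using U0 m by (simp add: mult_le_cancel_right1)
    finally show ?thesis .
  qed
  have "fls_section m e (f * fls_compose_power g m) $\<^sub>z j
      = (fls_compose_power g m * f) $\<^sub>z (int m * j + e)"
    by (simp add: fls_section_nth[OF m] mult.commute)
  also have "\<dots> = (\<Sum>i=int m * L..int m * U. fls_compose_power g m $\<^sub>z i * f $\<^sub>z (int m * j + e - i))"
    by (rule fls_times_nth_bounds[OF _ mU]) (simp add: fls_subdegree_compose_power[OF m] L_def)
  also have "\<dots> = (\<Sum>i\<in>(\<lambda>k. int m * k) ` {L..U}. fls_compose_power g m $\<^sub>z i * f $\<^sub>z (int m * j + e - i))"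
  proof (rule sum.mono_neutral_right)
    show "\<forall>i\<in>{int m * L..int m * U} - (\<lambda>k. int m * k) ` {L..U}.
        fls_compose_power g m $\<^sub>z i * f $\<^sub>z (int m * j + e - i) = 0"
    proof
      fix i assume i: "i \<in> {int m * L..int m * U} - (\<lambda>k. int m * k) ` {L..U}"
      have "\<not> int m dvd i"
      proof
        assume "int m dvd i"
        then obtain k where "i = int m * k" by blast
        moreover from this i m have "k \<in> {L..U}" by auto
        ultimately show False using i by blast
      qed
      thus "fls_compose_power g m $\<^sub>z i * f $\<^sub>z (int m * j + e - i) = 0"
        using m by (simp add: fls_nth_compose_power)
    qed
  qed (use m in auto)
  also have "\<dots> = (\<Sum>k=L..U. g $\<^sub>z k * fls_section m e f $\<^sub>z (j - k))"
    using m by (subst sum.reindex)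
      (auto simp: inj_on_def fls_nth_compose_power fls_section_nth algebra_simps intro!: sum.cong)
  also have "\<dots> = (g * fls_section m e f) $\<^sub>z j"
    by (rule fls_times_nth_bounds[symmetric]) (auto simp: L_def U_def)
  finally show "fls_section m e (f * fls_compose_power g m) $\<^sub>z j = (fls_section m e f * g) $\<^sub>z j"
    by (simp add: mult.commute)
qed

lemma indep_compose_power:
  fixes u :: "nat \<Rightarrow> nat \<Rightarrow> 'a::field fls"
  assumes m: "m > 0" and u: "indep n u"
  shows "indep n (\<lambda>l i. fls_compose_power (u l i) m)"
  unfolding indep_def
proof (intro allI impI)
  fix b l
  assume eq: "lcomb n b (\<lambda>l i. fls_compose_power (u l i) m) = (\<lambda>_. 0)" and l: "l < n"
  show "b l = 0"
  proof (rule fls_eqI)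
    \<comment> \<open>Sections are taken at every integer \<open>e\<close>, not only at residues
      modulo \<open>m\<close>; the coefficient of \<open>b l\<close> at \<open>e\<close> is then
      read off at exponent 0.\<close>
    fix e
    have "lcomb n (\<lambda>l. fls_section m e (b l)) u i = 0" for i
    proof -
      have "lcomb n (\<lambda>l. fls_section m e (b l)) u i
          = fls_section m e (lcomb n b (\<lambda>l i. fls_compose_power (u l i) m) i)"
        by (simp add: lcomb_def fls_section_sum[OF m] fls_section_mult_compose_power[OF m])
      also have "\<dots> = 0"
        unfolding eq by (rule fls_eqI) (simp add: fls_section_nth[OF m])
      finally show ?thesis .
    qed
    hence "fls_section m e (b l) = 0" using u l unfolding indep_def by blast
    hence "fls_section m e (b l) $\<^sub>z 0 = 0" by simp
    thus "b l $\<^sub>z e = 0 $\<^sub>z e" by (simp add: fls_section_nth[OF m])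
  qed
qed

section \<open>Semilinear operators given by matrices\<close>

definition mop :: "nat \<Rightarrow> ('k::field \<Rightarrow> 'k) \<Rightarrow> (nat \<Rightarrow> nat \<Rightarrow> 'k) \<Rightarrow> (nat \<Rightarrow> 'k) \<Rightarrow> nat \<Rightarrow> 'k" where
  "mop r s A v = (\<lambda>i. if i < r then s (\<Sum>j<r. A i j * v j) else 0)"

lemma semilinear_mop:
  assumes "c \<noteq> 0"
  shows "semilinear (fls_subst_div c) (mop r (fls_subst_div c) A)"
  unfolding semilinear_def
proof (intro allI ext)
  fix k b u i
  have "(\<Sum>j<r. A i j * lcomb k b u j) = (\<Sum>l<k. b l * (\<Sum>j<r. A i j * u l j))"
    unfolding lcomb_def sum_distrib_left by (subst sum.swap) (simp add: mult_ac)
  thus "mop r (fls_subst_div c) A (lcomb k b u) i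
      = lcomb k (\<lambda>l. fls_subst_div c (b l)) (\<lambda>l. mop r (fls_subst_div c) A (u l)) i"
    by (simp add: mop_def lcomb_def[of k "\<lambda>l. fls_subst_div c (b l)"] fls_subst_div_sum fls_subst_div_mult[OF assms])
qed

lemma mop_nonzero:
  assumes c: "c \<noteq> 0" and inv: "\<And>i k. i < r \<Longrightarrow> k < r \<Longrightarrow> (\<Sum>j<r. A' i j * A j k) = (if i = k then 1 else 0)"
    and v: "\<And>i. r \<le> i \<Longrightarrow> v i = 0" "v \<noteq> (\<lambda>_. 0)"
  shows "mop r (fls_subst_div c) A v \<noteq> (\<lambda>_. 0)"
proof
  assume eq: "mop r (fls_subst_div c) A v = (\<lambda>_. 0)"
  have z: "(\<Sum>k<r. A j k * v k) = 0" if "j < r" for j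
  proof -
    have "fls_subst_div c (\<Sum>k<r. A j k * v k) = 0"
      using fun_cong[OF eq, of j] that by (simp add: mop_def)
    thus ?thesis by (simp only: fls_subst_div_eq_0_iff[OF c])
  qed
  have "v i = 0" for i
  proof (cases "i < r")
    case True
    have "0 = (\<Sum>j<r. A' i j * (\<Sum>k<r. A j k * v k))" by (simp add: z)
    also have "\<dots> = (\<Sum>k<r. (\<Sum>j<r. A' i j * A j k) * v k)"
      unfolding sum_distrib_left sum_distrib_right by (subst sum.swap) (simp add: mult.assoc)
    also have "\<dots> = (\<Sum>k<r. if k = i then v k else 0)"
      using True by (intro sum.cong) (auto simp: inv)
    also have "\<dots> = v i" using True by simp
    finally show ?thesis by simp
  qed (simp add: v)
  thus False using v by auto
qed

text \<open>Pulling the inner substitution outside twists the left matrix: both composites become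
  the substitution for \<open>c * d\<close> applied to a matrix product times \<open>v\<close>. For
  c = 1/p and d = 1/q the equality of these products is the consistency condition.\<close>

lemma mop_commute:
  assumes c: "c \<noteq> 0" "d \<noteq> 0"
    and comm: "\<And>i k. i < r \<Longrightarrow> k < r \<Longrightarrow>
      (\<Sum>j<r. fls_subst_div (1 / c) (B i j) * A j k) = (\<Sum>j<r. fls_subst_div (1 / d) (A i j) * B j k)"
  shows "mop r (fls_subst_div c) A (mop r (fls_subst_div d) B v)
    = mop r (fls_subst_div d) B (mop r (fls_subst_div c) A v)"
proof -
  have *: "mop r (fls_subst_div c) A (mop r (fls_subst_div d) B v) i
      = fls_subst_div (c * d) (\<Sum>k<r. (\<Sum>j<r. fls_subst_div (1 / d) (A i j) * B j k) * v k)"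
    if "i < r" "c \<noteq> 0" "d \<noteq> 0" for i c d and A B :: "nat \<Rightarrow> nat \<Rightarrow> complex fls"
  proof -
    have "A i j = fls_subst_div d (fls_subst_div (1 / d) (A i j))" for j
      using that by (simp add: fls_subst_div_compose)
    hence "mop r (fls_subst_div c) A (mop r (fls_subst_div d) B v) i = fls_subst_div c
        (\<Sum>j<r. fls_subst_div d (fls_subst_div (1 / d) (A i j)) * fls_subst_div d (\<Sum>k<r. B j k * v k))"
      using that by (simp add: mop_def)
    also have "\<dots> = fls_subst_div (c * d) (\<Sum>j<r. fls_subst_div (1 / d) (A i j) * (\<Sum>k<r. B j k * v k))"
      by (simp only: fls_subst_div_mult[OF that(3), symmetric] fls_subst_div_sum[symmetric])
        (simp only: fls_subst_div_compose)
    also have "(\<Sum>j<r. fls_subst_div (1 / d) (A i j) * (\<Sum>k<r. B j k * v k))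
        = (\<Sum>k<r. (\<Sum>j<r. fls_subst_div (1 / d) (A i j) * B j k) * v k)"
      unfolding sum_distrib_left sum_distrib_right by (subst sum.swap) (simp add: mult.assoc)
    finally show ?thesis .
  qed
  show ?thesis
  proof
    fix i
    show "mop r (fls_subst_div c) A (mop r (fls_subst_div d) B v) i
      = mop r (fls_subst_div d) B (mop r (fls_subst_div c) A v) i"
    proof (cases "i < r")
      case True
      have "(\<Sum>k<r. (\<Sum>j<r. fls_subst_div (1 / d) (A i j) * B j k) * v k)
          = (\<Sum>k<r. (\<Sum>j<r. fls_subst_div (1 / c) (B i j) * A j k) * v k)"
        using True by (intro sum.cong) (simp_all add: comm)
      thus ?thesis using True c by (simp add: * mult.commute[of d c])
    qed (simp add: mop_def)
  qed
qed

subsection \<open>Vanishing of the slope\<close>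

text \<open>This serves twice: over the ramified extension, to refute a nonzero slope, and then over
  C((z)) with s = 0, to obtain a relation with constant coefficients.\<close>

lemma slope_zero:
  fixes F G :: "(nat \<Rightarrow> complex fls) \<Rightarrow> nat \<Rightarrow> complex fls"
  assumes F: "semilinear (fls_subst_div c) F" and G: "semilinear (fls_subst_div d) G"
    and c: "c \<noteq> 0" and d: "d \<noteq> 0"
    and ind: "\<And>n m :: int. c powi n * d powi m = 1 \<Longrightarrow> n = 0 \<and> m = 0"
    and comm: "\<And>v. F (G v) = G (F v)"
    and suppG: "\<And>v i. r \<le> i \<Longrightarrow> G v i = 0"
    and G0: "\<And>v. (\<And>i. r \<le> i \<Longrightarrow> v i = 0) \<Longrightarrow> v \<noteq> (\<lambda>_. 0) \<Longrightarrow> G v \<noteq> (\<lambda>_. 0)"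
    and w: "\<And>i. r \<le> i \<Longrightarrow> w i = 0" "w \<noteq> (\<lambda>_. 0)"
    and y: "y \<noteq> 0" and eig: "F w = (\<lambda>i. fls_const y * fls_X_intpow s * w i)"
  obtains n a where "s = 0" "indep (Suc n) (\<lambda>l. (G ^^ l) w)"
    "(G ^^ Suc n) w = lcomb (Suc n) (\<lambda>l. fls_const (a l)) (\<lambda>l. (G ^^ l) w)"
proof -
  define u where "u l = (G ^^ l) w" for l
  define f where "f = fls_const y * fls_X_intpow s"
  \<comment> \<open>Passing \<open>F\<close> through \<open>G\<close> twists the eigenvalue by
    \<open>d\<close>, which multiplies t^s by this factor; hence its powers in
    \<open>eigu\<close>.\<close>
  define D where "D = d powi (- s)"
  have f0: "f \<noteq> 0" using y by (simp add: f_def fls_shift_eq0_iff)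
  have usupp: "u l i = 0" if "r \<le> i" for l i
    using that w(1) suppG by (cases l) (simp_all add: u_def)
  have unz: "u l \<noteq> (\<lambda>_. 0)" for l
    by (induction l) (use w(2) G0 usupp in \<open>simp_all add: u_def\<close>)
  have eigu: "F (u l) = (\<lambda>i. fls_const (D ^ l) * f * u l i)" for l
  proof (induction l)
    case 0
    thus ?case by (simp add: u_def eig f_def)
  next
    case (Suc l)
    have "F (u (Suc l)) = G (F (u l))" by (simp add: u_def comm)
    also have "\<dots> = (\<lambda>i. fls_subst_div d (fls_const (D ^ l) * f) * G (u l) i)"
      by (subst Suc.IH) (rule semilinear_scale[OF G])
    also have "fls_subst_div d (fls_const (D ^ l) * f)
        = fls_const (D ^ Suc l) * f"
      by (simp only: f_def fls_subst_div_mult[OF d] fls_subst_div_X_intpow fls_subst_div_const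
          power_Suc fls_const_mult_const[symmetric] mult_ac D_def[symmetric])
    finally show ?case by (simp add: u_def)
  qed
  obtain n a where ia: "indep (Suc n) u" "u (Suc n) = lcomb (Suc n) a u"
    using minimal_relation[of r u] usupp unz by blast
  \<comment> \<open>\<open>F (u (Suc n))\<close> is computed in two ways, from the relation by
    semilinearity and from the eigenvalue of \<open>u (Suc n)\<close>. Independence then compares
    the coefficients one by one.\<close>
  have "lcomb (Suc n) (\<lambda>l. fls_subst_div c (a l) * (fls_const (D ^ l) * f)) u
      = F (u (Suc n))"
    unfolding ia(2) semilinearD[OF F] eigu by (simp add: lcomb_def mult.assoc)
  also have "\<dots> = (\<lambda>i. fls_const (D ^ Suc n) * f * u (Suc n) i)"
    by (rule eigu)
  also have "\<dots> = lcomb (Suc n) (\<lambda>l. fls_const (D ^ Suc n) * f * a l) u"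
    by (simp only: ia(2) lcomb_def sum_distrib_left mult.assoc)
  finally have "fls_subst_div c (a l) * (fls_const (D ^ l) * f)
      = fls_const (D ^ Suc n) * f * a l" if "l < Suc n" for l
    using indepD[OF ia(1)] that by blast
  hence "f * (fls_const (D ^ l) * fls_subst_div c (a l))
      = f * (fls_const (D ^ Suc n) * a l)" if "l < Suc n" for l
    using that by (simp only: mult_ac)
  hence "fls_const (D ^ l) * fls_subst_div c (a l)
      = fls_const (D ^ Suc n) * a l" if "l < Suc n" for l
    using that f0 mult_left_cancel by blast
  hence "(fls_const (D ^ l) * fls_subst_div c (a l)) $\<^sub>z j
      = (fls_const (D ^ Suc n) * a l) $\<^sub>z j" if "l < Suc n" for l j
    using that by simp
  hence coeffs: "D ^ l * c powi (- j) * a l $\<^sub>z j = D ^ Suc n * a l $\<^sub>z j"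
    if "l < Suc n" for l j
    using that by (simp only: fls_const_times_nth fls_subst_div_nth mult.assoc)
  have res: "j = 0 \<and> s = 0" if l: "l < Suc n" and j: "a l $\<^sub>z j \<noteq> 0" for l j
  proof -
    have eq: "d powi (- s * int l) * c powi (- j) = d powi (- s * int (Suc n))"
      using coeffs[OF l, of j] j
      by (simp only: D_def power_int_mult power_int_of_nat mult_right_cancel simp_thms)
    have "c powi (- j) * d powi (s * int (Suc n) - s * int l) = 1"
    proof -
      have "c powi (- j) * d powi (s * int (Suc n) - s * int l)
          = d powi (- s * int l) * c powi (- j) * d powi (s * int (Suc n))"
        using d by (simp add: power_int_add[symmetric] mult_ac flip: mult.assoc)
      also have "\<dots> = d powi (- s * int (Suc n)) * d powi (s * int (Suc n))" by (simp only: eq)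
      also have "\<dots> = 1" using d by (simp flip: power_int_add)
      finally show ?thesis .
    qed
    from ind[OF this] have "j = 0" "s * (int (Suc n) - int l) = 0" by (simp_all add: algebra_simps)
    thus ?thesis using l by auto
  qed
  \<comment> \<open>The resonance constraint needs some nonzero coefficient to act on. One exists
    because \<open>u (Suc n)\<close> is nonzero, \<open>G\<close> being injective on vectors
    supported below \<open>r\<close>.\<close>
  have s0: "s = 0"
  proof (rule ccontr)
    assume "s \<noteq> 0"
    hence "a l = 0" if "l < Suc n" for l using res[OF that] by (auto simp: fls_eq_iff)
    hence "lcomb (Suc n) a u = (\<lambda>_. 0)" by (simp add: lcomb_def)
    thus False using unz[of "Suc n"] ia(2) by simp
  qed
  have "a l = fls_const (a l $\<^sub>z 0)" if "l < Suc n" for l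
    using res[OF that] by (auto simp: fls_eq_iff)
  hence "lcomb (Suc n) a u = lcomb (Suc n) (\<lambda>l. fls_const (a l $\<^sub>z 0)) u"
    unfolding lcomb_def by (intro ext sum.cong) (auto simp del: sum.lessThan_Suc)
  thus thesis using that[of n "\<lambda>l. a l $\<^sub>z 0"] s0 ia unfolding u_def by simp
qed

text \<open>Positive real roots bring the equation from complex to real numbers, and its m-th power
  replaces the roots by p and q. The case m = 1 serves over C((z)) itself.\<close>

lemma mult_independent_root:
  assumes "mult_independent p q" "p > 0" "q > 0" "m > 0"
    and eq: "(1 / complex_of_real (root m p)) powi i * (1 / complex_of_real (root m q)) powi j = 1"
  shows "i = 0 \<and> j = 0"
proof -
  have *: "((1 / root m x) powi k) ^ m = x powi (- k)" if "x > 0" for x :: real and k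
  proof -
    have "((1 / root m x) powi k) ^ m = ((1 / root m x) ^ m) powi k"
      by (simp only: power_int_power power_int_power' mult.commute)
    also have "(1 / root m x) ^ m = inverse x"
      using assms(4) that by (simp add: power_divide real_root_pow_pos2 inverse_eq_divide)
    also have "inverse x powi k = x powi (- k)"
      by (simp add: power_int_inverse power_int_minus)
    finally show ?thesis .
  qed
  have "complex_of_real ((1 / root m p) powi i * (1 / root m q) powi j) = 1"
    using eq by simp
  hence "(1 / root m p) powi i * (1 / root m q) powi j = 1"
    by (simp only: of_real_eq_1_iff)
  hence "((1 / root m p) powi i * (1 / root m q) powi j) ^ m = 1 ^ m" by (rule arg_cong)
  hence "(real p) powi (- i) * (real q) powi (- j) = 1"
    using assms(2,3) by (simp only: power_mult_distrib * of_nat_0_less_iff power_one)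
  hence "- i = 0 \<and> - j = 0" using assms(1) unfolding mult_independent_def by blast
  thus ?thesis by simp
qed

lemma eigenvector_of_slope:
  assumes F: "semilinear (fls_subst_div c) F" and step: "\<And>l. u (Suc l) = F (u l)"
    and ind: "indep (Suc n) u" and rel: "u (Suc n) = lcomb (Suc n) a u"
    and c: "c \<noteq> 0" "cmod c < 1"
    and slope: "\<And>l. l \<le> n \<Longrightarrow> a l \<noteq> 0 \<Longrightarrow> int (Suc n - l) * s \<le> fls_subdegree (a l)"
    and l0: "l0 \<le> n" "a l0 \<noteq> 0" "int (Suc n - l0) * s = fls_subdegree (a l0)"
    and supp: "\<And>l i. r \<le> i \<Longrightarrow> u l i = 0"
  obtains y w where "y \<noteq> 0" "w \<noteq> (\<lambda>_. 0)" "\<And>i. r \<le> i \<Longrightarrow> w i = 0"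
    "F w = (\<lambda>i. fls_const y * fls_X_intpow s * w i)"
proof -
  obtain y b where yb: "y \<noteq> 0" "b n \<noteq> 0"
    "\<And>l. l \<le> n \<Longrightarrow> fls_const y * fls_X_intpow s * b l
       = (if l = 0 then 0 else fls_subst_div c (b (l - 1))) + fls_subst_div c (b n) * a l"
    using scalar_equation[where a = a and n = n and s = s, OF c slope l0] by blast
  show thesis
  proof (rule that)
    show "lcomb (Suc n) b u \<noteq> (\<lambda>_. 0)"
      using ind yb(2) unfolding indep_def by blast
    show "F (lcomb (Suc n) b u) = (\<lambda>i. fls_const y * fls_X_intpow s * lcomb (Suc n) b u i)"
      by (rule eigenvector_of_relation[OF F step rel yb(3)])
  qed (use yb supp in \<open>auto simp: lcomb_def\<close>)
qed

lemma companion_eigenvector: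
  fixes a :: "nat \<Rightarrow> complex"
  obtains \<mu> b where "b n = 1" "\<And>l. l \<le> n \<Longrightarrow> \<mu> * b l = (if l = 0 then 0 else b (l - 1)) + a l"
proof -
  define \<chi> where "\<chi> = Polynomial.monom 1 (Suc n) - (\<Sum>l\<le>n. Polynomial.monom (a l) l)"
  have "coeff \<chi> (Suc n) = 1"
    by (simp add: \<chi>_def coeff_sum)
  hence "degree \<chi> \<noteq> 0" by (metis coeff_eq_0 zero_less_Suc zero_neq_one neq0_conv)
  hence "\<not> constant (poly \<chi>)" by (simp add: constant_degree)
  then obtain \<mu> where "poly \<chi> \<mu> = 0" using fundamental_theorem_of_algebra by blast
  hence \<mu>: "\<mu> ^ Suc n = (\<Sum>l\<le>n. a l * \<mu> ^ l)"
    by (simp add: \<chi>_def poly_sum poly_monom)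
  \<comment> \<open>The coefficients of the quotient \<chi> / (X - \<mu>), as produced by Horner's
    scheme. Comparing coefficients in \<chi> = (X - \<mu>) \<Sum> b_l X^l gives the required
    recursion.\<close>
  define b where "b l = \<mu> ^ (n - l) - (\<Sum>i\<in>{l<..n}. a i * \<mu> ^ (i - Suc l))" for l
  have mb: "\<mu> * b l = \<mu> ^ (Suc n - l) - (\<Sum>i\<in>{l<..n}. a i * \<mu> ^ (i - l))" if "l \<le> n" for l
  proof -
    have "\<mu> * (\<Sum>i\<in>{l<..n}. a i * \<mu> ^ (i - Suc l)) = (\<Sum>i\<in>{l<..n}. a i * \<mu> ^ (i - l))"
      unfolding sum_distrib_left
    proof (rule sum.cong)
      fix i assume "i \<in> {l<..n}"
      hence "i - l = Suc (i - Suc l)" by auto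
      thus "\<mu> * (a i * \<mu> ^ (i - Suc l)) = a i * \<mu> ^ (i - l)" by simp
    qed simp
    thus ?thesis using that by (simp add: b_def right_diff_distrib Suc_diff_le)
  qed
  show thesis
  proof (rule that)
    show "b n = 1" by (simp add: b_def)
    fix l assume l: "l \<le> n"
    show "\<mu> * b l = (if l = 0 then 0 else b (l - 1)) + a l"
    proof (cases l)
      case 0
      have "{..n} = insert 0 {0<..n}" by auto
      hence "\<mu> ^ Suc n = a 0 + (\<Sum>i\<in>{0<..n}. a i * \<mu> ^ i)" unfolding \<mu> by simp
      thus ?thesis using mb[OF l] 0 by simp
    next
      case (Suc k)
      have "{k<..n} = insert l {l<..n}" using l Suc by auto
      hence "b k = \<mu> ^ (n - k) - (a l + (\<Sum>i\<in>{l<..n}. a i * \<mu> ^ (i - l)))"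
        by (simp add: b_def Suc)
      thus ?thesis using mb[OF l] Suc l by simp
    qed
  qed
qed

lemma mop_compose_power:
  assumes m: "m > 0" and c: "c' ^ m = c" "c' \<noteq> 0"
  shows "mop r (fls_subst_div c') (\<lambda>i j. fls_compose_power (A i j) m) (\<lambda>i. fls_compose_power (v i) m)
    = (\<lambda>i. fls_compose_power (mop r (fls_subst_div c) A v i) m)"
proof -
  have sum: "fls_compose_power (sum f I) m = (\<Sum>i\<in>I. fls_compose_power (f i) m)"
    for f :: "nat \<Rightarrow> complex fls" and I
    by (induction I rule: infinite_finite_induct) simp_all
  show ?thesis
    by (rule ext) (simp add: mop_def fls_subst_div_compose_power[OF c(1) m c(2), symmetric] sum)
qed

lemma eigenvector_slope_zero:
  fixes A B A' B' :: "nat \<Rightarrow> nat \<Rightarrow> complex fls"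
  assumes pq: "p \<ge> 2" "q \<ge> 2" "mult_independent p q" and r: "r > 0"
    and comm: "\<And>i k. i < r \<Longrightarrow> k < r \<Longrightarrow>
      (\<Sum>j<r. fls_subst_div (of_nat p) (B i j) * A j k) = (\<Sum>j<r. fls_subst_div (of_nat q) (A i j) * B j k)"
    and invA: "\<And>i k. i < r \<Longrightarrow> k < r \<Longrightarrow> (\<Sum>j<r. A' i j * A j k) = (if i = k then 1 else 0)"
    and invB: "\<And>i k. i < r \<Longrightarrow> k < r \<Longrightarrow> (\<Sum>j<r. B' i j * B j k) = (if i = k then 1 else 0)"
  obtains y w where "y \<noteq> 0" "w \<noteq> (\<lambda>_. 0)" "\<And>i. r \<le> i \<Longrightarrow> w i = 0"
    "mop r (fls_subst_div (1 / of_nat p)) A w = (\<lambda>i. fls_const y * w i)"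
proof -
  define c where "c = 1 / complex_of_nat p"
  define F where "F = mop r (fls_subst_div c) A"
  have c: "c \<noteq> 0" "cmod c < 1" using pq(1) by (simp_all add: c_def norm_divide)
  have F: "semilinear (fls_subst_div c) F" unfolding F_def by (rule semilinear_mop[OF c(1)])
  \<comment> \<open>The orbit starts at the first basis vector, which is nonzero and supported below
    \<open>r\<close> because r > 0.\<close>
  define u where "u l = (F ^^ l) (\<lambda>i. if i = 0 then 1 else 0)" for l
  have step: "u (Suc l) = F (u l)" for l by (simp add: u_def)
  have supp: "u l i = 0" if "r \<le> i" for l i
    using that r by (cases l) (auto simp: u_def F_def mop_def)
  have unz: "u l \<noteq> (\<lambda>_. 0)" for l
  proof (induction l)
    case 0 show ?case by (auto simp: u_def fun_eq_iff)
  next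
    case (Suc l)
    show ?case unfolding step F_def by (rule mop_nonzero[OF c(1) invA supp Suc])
  qed
  obtain n a where ind: "indep (Suc n) u" and rel: "u (Suc n) = lcomb (Suc n) a u"
    using minimal_relation[of r u] supp unz by blast
  have "\<exists>l\<le>n. a l \<noteq> 0"
  proof (rule ccontr)
    assume "\<not> (\<exists>l\<le>n. a l \<noteq> 0)"
    hence "lcomb (Suc n) a u = (\<lambda>_. 0)" by (auto simp: lcomb_def)
    thus False using unz[of "Suc n"] rel by simp
  qed
  then obtain l0 where l0: "l0 \<le> n" "a l0 \<noteq> 0"
    "\<And>l. l \<le> n \<Longrightarrow> a l \<noteq> 0 \<Longrightarrow>
      int (Suc n - l) * fls_subdegree (a l0) \<le> int (Suc n - l0) * fls_subdegree (a l)"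
    using minimal_slope by blast
  \<comment> \<open>The least slope is s/m, not necessarily in lowest terms. Adjoining t with t^m =
    z multiplies orders by m, so t^s has the required order.\<close>
  define m where "m = Suc n - l0"
  define s where "s = fls_subdegree (a l0)"
  have m: "m > 0" using l0(1) by (simp add: m_def)
  define \<iota> where "\<iota> f = fls_compose_power f m" for f :: "complex fls"
  define c' where "c' = 1 / complex_of_real (root m p)"
  define d' where "d' = 1 / complex_of_real (root m q)"
  have root: "root m x > 1" "complex_of_real (root m x) ^ m = of_real x" if "x \<ge> 2" for x :: real
    using that m real_root_pow_pos2[OF m, of x] by (simp_all flip: of_real_power)
  have c': "c' ^ m = c" "c' \<noteq> 0" "cmod c' < 1" and d': "d' \<noteq> 0"
    using root[of p] root[of q] pq(1,2)
    by (simp_all add: c'_def d'_def c_def power_divide norm_divide)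
  define F' where "F' = mop r (fls_subst_div c') (\<lambda>i j. \<iota> (A i j))"
  define G' where "G' = mop r (fls_subst_div d') (\<lambda>i j. \<iota> (B i j))"
  define u' where "u' l i = \<iota> (u l i)" for l i
  have F': "semilinear (fls_subst_div c') F'" unfolding F'_def by (rule semilinear_mop[OF c'(2)])
  have G': "semilinear (fls_subst_div d') G'" unfolding G'_def by (rule semilinear_mop[OF d'])
  have step': "u' (Suc l) = F' (u' l)" for l
    unfolding F'_def u'_def \<iota>_def step F_def by (rule mop_compose_power[OF m c'(1,2), symmetric])
  have ind': "indep (Suc n) u'"
    unfolding u'_def \<iota>_def by (rule indep_compose_power[OF m ind])
  have \<iota>_sum: "\<iota> (sum f I) = (\<Sum>i\<in>I. \<iota> (f i))" for f :: "nat \<Rightarrow> complex fls" and I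
    by (induction I rule: infinite_finite_induct) (simp_all add: \<iota>_def)
  have \<iota>_mult: "\<iota> (f * g) = \<iota> f * \<iota> g" for f g by (simp add: \<iota>_def)
  have rel': "u' (Suc n) = lcomb (Suc n) (\<lambda>l. \<iota> (a l)) u'"
    unfolding u'_def rel lcomb_def \<iota>_sum \<iota>_mult ..
  have \<iota>0: "\<iota> f \<noteq> 0 \<longleftrightarrow> f \<noteq> 0" for f by (simp add: \<iota>_def fls_compose_power_eq_0_iff[OF m])
  have \<iota>sd: "fls_subdegree (\<iota> f) = int m * fls_subdegree f" for f
    by (simp add: \<iota>_def fls_subdegree_compose_power[OF m])
  have slope: "int (Suc n - l) * s \<le> fls_subdegree (\<iota> (a l))" if "l \<le> n" "\<iota> (a l) \<noteq> 0" for l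
    using l0(3)[of l] that \<iota>0 by (simp add: \<iota>sd s_def m_def)
  have slope0: "int (Suc n - l0) * s = fls_subdegree (\<iota> (a l0))"
    by (simp add: \<iota>sd s_def m_def)
  have supp': "u' l i = 0" if "r \<le> i" for l i using supp that by (simp add: u'_def \<iota>_def)
  have \<iota>l0: "\<iota> (a l0) \<noteq> 0" using l0(2) \<iota>0 by simp
  obtain y' w' where w': "y' \<noteq> 0" "w' \<noteq> (\<lambda>_. 0)" "\<And>i. r \<le> i \<Longrightarrow> w' i = 0"
    "F' w' = (\<lambda>i. fls_const y' * fls_X_intpow s * w' i)"
    using eigenvector_of_slope[where u = u' and n = n and s = s and r = r,
        OF F' step' ind' rel' c'(2,3) slope l0(1) \<iota>l0 slope0 supp']
    by metis
  have \<iota>\<delta>: "\<iota> (if i = k then 1 else 0) = (if i = k then 1 else 0)" for i k :: nat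
    using m by (simp add: \<iota>_def)
  have \<iota>invB: "(\<Sum>j<r. \<iota> (B' i j) * \<iota> (B j k)) = (if i = k then 1 else 0)" if "i < r" "k < r" for i k
    using arg_cong[OF invB[OF that], of \<iota>] unfolding \<iota>_sum \<iota>_mult \<iota>\<delta> .
  have sub: "fls_subst_div (complex_of_real (root m x)) (\<iota> f) = \<iota> (fls_subst_div (of_real x) f)"
    if "x \<ge> 2" for x :: real and f
    unfolding \<iota>_def using root[OF that] by (intro fls_subst_div_compose_power m) auto
  have \<iota>comm: "(\<Sum>j<r. fls_subst_div (1 / c') (\<iota> (B i j)) * \<iota> (A j k))
      = (\<Sum>j<r. fls_subst_div (1 / d') (\<iota> (A i j)) * \<iota> (B j k))" if "i < r" "k < r" for i k
    using arg_cong[OF comm[OF that], of \<iota>] pq(1,2)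
    by (simp add: \<iota>_sum \<iota>_mult c'_def d'_def sub)
  have indep: "i = 0 \<and> j = 0" if "c' powi i * d' powi j = 1" for i j
    using mult_independent_root[OF pq(3) _ _ m] pq that unfolding c'_def d'_def by simp
  have "s = 0"
  proof (rule slope_zero[OF F' G' c'(2) d' indep _ _ _ w'(3,2,1,4)])
    show "F' (G' v) = G' (F' v)" for v
      unfolding F'_def G'_def by (rule mop_commute[OF c'(2) d' \<iota>comm])
    show "G' v i = 0" if "r \<le> i" for v i using that by (simp add: G'_def mop_def)
    show "G' v \<noteq> (\<lambda>_. 0)" if "\<And>i. r \<le> i \<Longrightarrow> v i = 0" "v \<noteq> (\<lambda>_. 0)" for v
      unfolding G'_def by (rule mop_nonzero[OF d' \<iota>invB that])
  qed
  \<comment> \<open>With s = 0 minimality says that all nonzero \<open>a l\<close> have nonnegative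
    order, so the unramified relation itself meets the slope conditions. The eigenvector is
    constructed anew over C((z)), and \<open>w'\<close> is discarded.\<close>
  have slope1: "int (Suc n - l) * 0 \<le> fls_subdegree (a l)" if "l \<le> n" "a l \<noteq> 0" for l
    using l0(3)[OF that] m \<open>s = 0\<close> by (simp add: s_def m_def zero_le_mult_iff)
  have slope2: "int (Suc n - l0) * 0 = fls_subdegree (a l0)" using \<open>s = 0\<close> by (simp add: s_def)
  obtain y w where "y \<noteq> 0" "w \<noteq> (\<lambda>_. 0)" "\<And>i. r \<le> i \<Longrightarrow> w i = 0"
    "F w = (\<lambda>i. fls_const y * fls_X_intpow 0 * w i)"
    using eigenvector_of_slope[where u = u and n = n and s = 0 and r = r,
        OF F step ind rel c slope1 l0(1,2) slope2 supp] by metis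
  thus thesis using that[of y w] by (simp add: F_def c_def)
qed

subsection \<open>Common eigenvectors\<close>

lemma common_eigenvector:
  fixes A B A' B' :: "nat \<Rightarrow> nat \<Rightarrow> complex fls"
  assumes pq: "p \<ge> 2" "q \<ge> 2" "mult_independent p q" and r: "r > 0"
    and comm: "\<And>i k. i < r \<Longrightarrow> k < r \<Longrightarrow>
      (\<Sum>j<r. fls_subst_div (of_nat p) (B i j) * A j k) = (\<Sum>j<r. fls_subst_div (of_nat q) (A i j) * B j k)"
    and invA: "\<And>i k. i < r \<Longrightarrow> k < r \<Longrightarrow> (\<Sum>j<r. A' i j * A j k) = (if i = k then 1 else 0)"
    and invB: "\<And>i k. i < r \<Longrightarrow> k < r \<Longrightarrow> (\<Sum>j<r. B' i j * B j k) = (if i = k then 1 else 0)"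
  shows "\<exists>x y w. x \<noteq> 0 \<and> y \<noteq> 0 \<and> (\<exists>i<r. w i \<noteq> 0)
    \<and> (\<forall>i<r. (\<Sum>j<r. A i j * w j) = fls_const x * fls_subst_div (of_nat p) (w i))
    \<and> (\<forall>i<r. (\<Sum>j<r. B i j * w j) = fls_const y * fls_subst_div (of_nat q) (w i))"
proof -
  define c where "c = 1 / complex_of_nat p"
  define d where "d = 1 / complex_of_nat q"
  define F where "F = mop r (fls_subst_div c) A"
  define G where "G = mop r (fls_subst_div d) B"
  have c: "c \<noteq> 0" and d: "d \<noteq> 0" using pq by (simp_all add: c_def d_def)
  have F: "semilinear (fls_subst_div c) F" unfolding F_def by (rule semilinear_mop[OF c])
  have G: "semilinear (fls_subst_div d) G" unfolding G_def by (rule semilinear_mop[OF d])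
  obtain x v where x: "x \<noteq> 0" and v: "v \<noteq> (\<lambda>_. 0)" "\<And>i. r \<le> i \<Longrightarrow> v i = 0"
    and eig: "F v = (\<lambda>i. fls_const x * v i)"
    using eigenvector_slope_zero[OF pq r comm invA invB] unfolding F_def c_def by metis
  have FG: "F (G v) = G (F v)" for v
    unfolding F_def G_def by (rule mop_commute[OF c d]) (simp add: comm c_def d_def)
  have suppG: "G v i = 0" if "r \<le> i" for v i using that by (simp add: G_def mop_def)
  have G0: "G v \<noteq> (\<lambda>_. 0)" if "\<And>i. r \<le> i \<Longrightarrow> v i = 0" "v \<noteq> (\<lambda>_. 0)" for v
    unfolding G_def by (rule mop_nonzero[OF d invB that])
  have indep: "i = 0 \<and> j = 0" if "c powi i * d powi j = 1" for i j
    using mult_independent_root[OF pq(3), of 1] pq that unfolding c_def d_def by simp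
  have eig0: "F v = (\<lambda>i. fls_const x * fls_X_intpow 0 * v i)" by (simp add: eig)
  define u where "u l = (G ^^ l) v" for l
  obtain n a where ind: "indep (Suc n) u"
    and rel: "u (Suc n) = lcomb (Suc n) (\<lambda>l. fls_const (a l)) u"
    using slope_zero[OF F G c d indep FG suppG G0 v(2,1) x eig0] unfolding u_def by metis
  \<comment> \<open>Constants are fixed by the substitution in \<open>G\<close>, so every vector of
    the orbit has the same eigenvalue \<open>x\<close> under \<open>F\<close>.\<close>
  have eigu: "F (u l) = (\<lambda>i. fls_const x * u l i)" for l
  proof (induction l)
    case (Suc l)
    have "F (u (Suc l)) = G (F (u l))" by (simp add: u_def FG)
    thus ?case unfolding Suc.IH semilinear_scale[OF G] by (simp add: u_def)
  qed (simp add: u_def eig)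
  obtain \<mu> b where b: "b n = 1" "\<And>l. l \<le> n \<Longrightarrow> \<mu> * b l = (if l = 0 then 0 else b (l - 1)) + a l"
    using companion_eigenvector by blast
  \<comment> \<open>Constant coefficients keep \<open>w\<close> inside the eigenspace of
    \<open>F\<close> for \<open>x\<close>; on such combinations \<open>G\<close> acts through an
    ordinary complex companion matrix, which has an eigenvector.\<close>
  define w where "w = lcomb (Suc n) (\<lambda>l. fls_const (b l)) u"
  have wnz: "w \<noteq> (\<lambda>_. 0)"
  proof
    assume "w = (\<lambda>_. 0)"
    hence "fls_const (b n) = 0" using ind unfolding w_def indep_def by blast
    thus False by (simp add: b(1))
  qed
  have wsupp: "w i = 0" if "r \<le> i" for i
  proof -
    have "u l i = 0" for l using that v(2) suppG by (cases l) (simp_all add: u_def)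
    thus ?thesis by (simp add: w_def lcomb_def)
  qed
  have Gw: "G w = (\<lambda>i. fls_const \<mu> * w i)"
    unfolding w_def
  proof (rule eigenvector_of_relation[OF G _ rel])
    show "u (Suc l) = G (u l)" for l by (simp add: u_def)
    fix l assume "l \<le> n"
    hence "fls_const (\<mu> * b l) = fls_const ((if l = 0 then 0 else b (l - 1)) + a l)"
      by (simp only: b(2))
    thus "fls_const \<mu> * fls_const (b l) = (if l = 0 then 0 else fls_subst_div d (fls_const (b (l - 1))))
        + fls_subst_div d (fls_const (b n)) * fls_const (a l)"
      by (simp add: fls_const_mult_const fls_plus_const b(1) split: if_splits)
  qed
  have Fw: "F w = (\<lambda>i. fls_const x * w i)"
    unfolding w_def semilinearD[OF F] eigu
    by (simp add: lcomb_def sum_distrib_left distrib_left mult_ac del: fls_const_mult_const)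
  have \<mu>: "\<mu> \<noteq> 0" using G0[OF wsupp wnz] Gw by auto
  \<comment> \<open>Undoing the substitution built into the operator turns F w = x w into A w = x
    w(z/p), and likewise for \<open>G\<close>.\<close>
  have unfold_mop: "(\<Sum>j<r. M i j * w j) = fls_const z * fls_subst_div e (w i)"
    if "mop r (fls_subst_div (1 / e)) M w = (\<lambda>i. fls_const z * w i)" "e \<noteq> 0" "i < r" for M z e i
  proof -
    have "fls_subst_div (1 / e) (\<Sum>j<r. M i j * w j) = fls_const z * w i"
      using fun_cong[OF that(1), of i] that(3) by (simp add: mop_def)
    hence "fls_subst_div e (fls_subst_div (1 / e) (\<Sum>j<r. M i j * w j)) = fls_subst_div e (fls_const z * w i)"
      by simp
    thus ?thesis using that(2) by (simp add: fls_subst_div_compose fls_subst_div_mult)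
  qed
  have "\<exists>i<r. w i \<noteq> 0" using wnz wsupp by (metis not_le)
  moreover have "\<forall>i<r. (\<Sum>j<r. A i j * w j) = fls_const x * fls_subst_div (of_nat p) (w i)"
    using pq Fw by (auto intro!: unfold_mop simp: F_def c_def)
  moreover have "\<forall>i<r. (\<Sum>j<r. B i j * w j) = fls_const \<mu> * fls_subst_div (of_nat q) (w i)"
    using pq Gw by (auto intro!: unfold_mop simp: G_def d_def)
  ultimately show ?thesis using x \<mu> by blast
qed

text \<open>The exponent is minus the integer part of the logarithm of |x| to base p; the remaining
  fractional part lies in [0, 1).\<close>

lemma power_int_scaling:
  fixes x :: complex
  assumes "p \<ge> 2" "x \<noteq> 0"
  obtains k where "1 \<le> cmod (x * of_nat p powi k)" "cmod (x * of_nat p powi k) < real p"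
proof -
  define k where "k = - \<lfloor>log p (cmod x)\<rfloor>"
  have p: "real p > 1" using assms by simp
  have eq: "cmod (x * of_nat p powi k) = p powr (log p (cmod x) - of_int \<lfloor>log p (cmod x)\<rfloor>)"
    using assms p by (simp add: k_def norm_mult norm_divide norm_power_int power_int_minus powr_diff
        powr_real_of_int' field_simps)
  show thesis
  proof (rule that)
    show "1 \<le> cmod (x * of_nat p powi k)"
      unfolding eq using p by (simp add: ge_one_powr_ge_zero)
    have "p powr (log p (cmod x) - of_int \<lfloor>log p (cmod x)\<rfloor>) < p powr 1"
      using p by (intro powr_less_mono) linarith+
    thus "cmod (x * of_nat p powi k) < real p" unfolding eq using p by simp
  qed
qed

lemma GL_iff_det:
  fixes M :: "'a::field mat"
  shows "M \<in> GL r \<longleftrightarrow> M \<in> carrier_mat r r \<and> det M \<noteq> 0"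
proof
  assume "M \<in> GL r"
  hence M: "M \<in> carrier_mat r r" "invertible_mat M" by (auto simp: GL_def)
  then obtain N where N: "M * N = 1\<^sub>m r" "N * M = 1\<^sub>m (dim_row N)"
    unfolding invertible_mat_def inverts_mat_def by auto
  have "dim_col N = r" using arg_cong[OF N(1), of dim_col] by simp
  moreover have "dim_row N = r" using arg_cong[OF N(2), of dim_col] M by simp
  ultimately have "N \<in> carrier_mat r r" by blast
  hence "det M * det N = 1" using det_mult[OF M(1)] N(1) by (metis det_one)
  thus "M \<in> carrier_mat r r \<and> det M \<noteq> 0" using M by auto
next
  assume M: "M \<in> carrier_mat r r \<and> det M \<noteq> 0"
  then obtain N where "N \<in> carrier_mat r r" "N * M = 1\<^sub>m r" "M * N = 1\<^sub>m r"
    using det_non_zero_imp_unit[of M r "()"] unfolding Units_def ring_mat_def by auto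
  thus "M \<in> GL r" using M unfolding GL_def invertible_mat_def inverts_mat_def by auto
qed

lemma GL_inverse:
  fixes M :: "'a::field mat"
  assumes "M \<in> GL r"
  obtains N where "N \<in> carrier_mat r r" "N * M = 1\<^sub>m r" "M * N = 1\<^sub>m r"
  using assms det_non_zero_imp_unit[of M r "()"]
  unfolding GL_iff_det Units_def ring_mat_def by auto

lemma mat_mult_nth:
  assumes "M \<in> carrier_mat r n" "N \<in> carrier_mat n k" "i < r" "j < k"
  shows "(M * N) $$ (i, j) = (\<Sum>l<n. M $$ (i, l) * N $$ (l, j))"
  using assms by (simp add: scalar_prod_def atLeast0LessThan)

lemma common_eigenvector_pair:
  assumes pq: "p \<ge> 2" "q \<ge> 2" "mult_independent p q" and r: "r > 0"
    and AB: "consistent_pair p q r A B"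
  shows "\<exists>x y w. 1 \<le> cmod x \<and> cmod x < real p \<and> (\<exists>i<r. w i \<noteq> 0)
    \<and> (\<forall>i<r. (\<Sum>j<r. A $$ (i, j) * w j) = fls_const x * fls_subst_div (of_nat p) (w i))
    \<and> (\<forall>i<r. (\<Sum>j<r. B $$ (i, j) * w j) = fls_const y * fls_subst_div (of_nat q) (w i))"
proof -
  have A: "A \<in> carrier_mat r r" "A \<in> GL r" and B: "B \<in> carrier_mat r r" "B \<in> GL r"
    and eq: "mat_subst_div p B * A = mat_subst_div q A * B"
    using AB by (auto simp: consistent_pair_def GL_def)
  obtain A' where A': "A' \<in> carrier_mat r r" "A' * A = 1\<^sub>m r" using GL_inverse[OF A(2)] by metis
  obtain B' where B': "B' \<in> carrier_mat r r" "B' * B = 1\<^sub>m r" using GL_inverse[OF B(2)] by metis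
  have comm: "(\<Sum>j<r. fls_subst_div (of_nat p) (B $$ (i, j)) * A $$ (j, k))
      = (\<Sum>j<r. fls_subst_div (of_nat q) (A $$ (i, j)) * B $$ (j, k))" if "i < r" "k < r" for i k
    using arg_cong[OF eq, of "\<lambda>M. M $$ (i, k)"] that A(1) B(1)
      mat_mult_nth[of "mat_subst_div p B" r r A r i k] mat_mult_nth[of "mat_subst_div q A" r r B r i k]
    by (simp add: mat_subst_div_def del: index_mult_mat)
  have inv: "(\<Sum>j<r. N $$ (i, j) * M $$ (j, k)) = (if i = k then 1 else 0)"
    if "N * M = 1\<^sub>m r" "N \<in> carrier_mat r r" "M \<in> carrier_mat r r" "i < r" "k < r"
    for M N :: "complex fls mat" and i k
    using mat_mult_nth[OF that(2,3,4,5)] that by (simp del: index_mult_mat)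
  have "\<exists>x y w. x \<noteq> 0 \<and> y \<noteq> 0 \<and> (\<exists>i<r. w i \<noteq> 0)
    \<and> (\<forall>i<r. (\<Sum>j<r. A $$ (i, j) * w j) = fls_const x * fls_subst_div (of_nat p) (w i))
    \<and> (\<forall>i<r. (\<Sum>j<r. B $$ (i, j) * w j) = fls_const y * fls_subst_div (of_nat q) (w i))"
  proof (rule common_eigenvector[where A = "\<lambda>i j. A $$ (i, j)" and B = "\<lambda>i j. B $$ (i, j)"
        and A' = "\<lambda>i j. A' $$ (i, j)" and B' = "\<lambda>i j. B' $$ (i, j)", OF pq r])
    fix i k assume ik: "i < r" "k < r"
    show "(\<Sum>j<r. fls_subst_div (of_nat p) (B $$ (i, j)) * A $$ (j, k))
      = (\<Sum>j<r. fls_subst_div (of_nat q) (A $$ (i, j)) * B $$ (j, k))" by (rule comm[OF ik])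
    show "(\<Sum>j<r. A' $$ (i, j) * A $$ (j, k)) = (if i = k then 1 else 0)"
      by (rule inv[OF A'(2,1) A(1) ik])
    show "(\<Sum>j<r. B' $$ (i, j) * B $$ (j, k)) = (if i = k then 1 else 0)"
      by (rule inv[OF B'(2,1) B(1) ik])
  qed
  then obtain x y w where w: "x \<noteq> 0" "y \<noteq> 0" "\<exists>i<r. w i \<noteq> 0"
    "\<And>i. i < r \<Longrightarrow> (\<Sum>j<r. A $$ (i, j) * w j) = fls_const x * fls_subst_div (of_nat p) (w i)"
    "\<And>i. i < r \<Longrightarrow> (\<Sum>j<r. B $$ (i, j) * w j) = fls_const y * fls_subst_div (of_nat q) (w i)"
    by blast
  obtain k where k: "1 \<le> cmod (x * of_nat p powi k)" "cmod (x * of_nat p powi k) < real p"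
    using power_int_scaling[OF pq(1) w(1)] by blast
  \<comment> \<open>Substitution multiplies z^k by e^(-k), so replacing w by z^k w multiplies the
    eigenvalue by e^k. The exponent is chosen for \<open>x\<close>; the eigenvalue for B merely
    follows along.\<close>
  have scale: "(\<Sum>j<r. M j * (fls_X_intpow k * w j))
      = fls_const (z * e powi k) * fls_subst_div e (fls_X_intpow k * v)"
    if "(\<Sum>j<r. M j * w j) = fls_const z * fls_subst_div e v" "e \<noteq> 0" for M z e v
  proof -
    have "fls_const (z * e powi k) * fls_subst_div e (fls_X_intpow k * v)
        = fls_const (z * e powi k * e powi (- k)) * (fls_X_intpow k * fls_subst_div e v)"
      by (simp only: fls_subst_div_mult[OF that(2)] fls_subst_div_X_intpow
          fls_const_mult_const[symmetric] mult_ac)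
    also have "z * e powi k * e powi (- k) = z" using that(2) by (simp add: power_int_minus)
    also have "fls_const z * (fls_X_intpow k * fls_subst_div e v)
        = fls_X_intpow k * (\<Sum>j<r. M j * w j)" unfolding that(1) by (simp only: mult_ac)
    also have "\<dots> = (\<Sum>j<r. M j * (fls_X_intpow k * w j))"
      unfolding sum_distrib_left by (simp only: mult_ac)
    finally show ?thesis by simp
  qed
  have nz: "\<exists>i<r. fls_X_intpow k * w i \<noteq> 0" using w(3) by (simp add: fls_shift_eq0_iff)
  have EA: "(\<Sum>j<r. A $$ (i, j) * (fls_X_intpow k * w j))
      = fls_const (x * of_nat p powi k) * fls_subst_div (of_nat p) (fls_X_intpow k * w i)"
    if "i < r" for i
    by (rule scale[where M = "\<lambda>j. A $$ (i, j)", OF w(4)[OF that]]) (use pq in simp)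
  have EB: "(\<Sum>j<r. B $$ (i, j) * (fls_X_intpow k * w j))
      = fls_const (y * of_nat q powi k) * fls_subst_div (of_nat q) (fls_X_intpow k * w i)"
    if "i < r" for i
    by (rule scale[where M = "\<lambda>j. B $$ (i, j)", OF w(5)[OF that]]) (use pq in simp)
  show ?thesis
    by (rule exI[of _ "x * of_nat p powi k"], rule exI[of _ "y * of_nat q powi k"],
        rule exI[of _ "\<lambda>i. fls_X_intpow k * w i"]) (use k nz EA EB in blast)
qed

subsection \<open>Intertwiners of restricted matrices\<close>

text \<open>The quotient of two moduli in [1, p) lies strictly between 1/p and p, and the only power
  of p there is p^0.\<close>

lemma restricted_ratio:
  fixes a b :: complex
  assumes p: "p \<ge> 2" and a: "1 \<le> cmod a" "cmod a < real p" and b: "1 \<le> cmod b" "cmod b < real p"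
    and eq: "a = of_nat p powi N * b"
  shows "N = 0"
proof -
  have pos: False if "N > 0" "1 \<le> cmod b" "cmod a < real p" "a = of_nat p powi N * b"
    for a b :: complex and N :: int
  proof -
    have "real p powi 1 \<le> real p powi N" using p that(1) by (intro power_int_increasing) auto
    hence "real p * 1 \<le> real p powi N * cmod b" using that(2) p by (intro mult_mono) auto
    thus False using that(3,4) by (simp add: norm_mult norm_power_int)
  qed
  have "b = of_nat p powi (- N) * a" using eq p by (simp add: power_int_minus)
  hence "\<not> N < 0" using pos[of "- N" a b] a b by auto
  moreover have "\<not> N > 0" using pos[of N b a] a b eq by auto
  ultimately show ?thesis by simp
qed

text \<open>A Sylvester equation with disjoint spectra. After A1 is made triangular, the first
  nonzero column j of \<open>Y\<close> would be an eigenvector of A0 for p^N times the diagonal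
  entry \<open>T $$ (j, j)\<close>, an eigenvalue of A1; restrictedness forbids this for N \<noteq>
  0.\<close>

lemma restricted_intertwiner_zero:
  assumes p: "p \<ge> 2" and A0: "A0 \<in> carrier_mat r r" "p_restricted p A0"
    and A1: "A1 \<in> carrier_mat r r" "p_restricted p A1"
    and X: "X \<in> carrier_mat r r" and N: "N \<noteq> 0"
    and eq: "A0 * X = (of_nat p powi N) \<cdot>\<^sub>m (X * A1)"
  shows "X = 0\<^sub>m r r"
proof -
  obtain as where "char_poly A1 = (\<Prod>a\<leftarrow>as. [:- a, 1:])"
    using char_poly_factorized[OF A1(1)] by blast
  then obtain T where T: "T \<in> carrier_mat r r" "upper_triangular T" "similar_mat A1 T"
    using schur_decomposition_exists[OF A1(1)] by blast
  then obtain P Q where PQ: "P \<in> carrier_mat r r" "Q \<in> carrier_mat r r"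
    "P * Q = 1\<^sub>m r" "Q * P = 1\<^sub>m r" "A1 = P * T * Q"
    using A1(1) unfolding similar_mat_def similar_mat_wit_def Let_def by auto
  define Y where "Y = X * P"
  have Y: "Y \<in> carrier_mat r r" using X PQ by (simp add: Y_def)
  have "A1 * P = P * T"
    using PQ(1,2,4) T(1) unfolding PQ(5) by (simp add: assoc_mult_mat[of _ r r _ r _ r])
  hence "X * A1 * P = Y * T"
    using X PQ(1) T(1) A1(1) by (simp add: Y_def assoc_mult_mat[of _ r r _ r _ r])
  moreover have "A0 * Y = A0 * X * P"
    using A0(1) X PQ(1) by (simp add: Y_def assoc_mult_mat[of _ r r _ r _ r])
  ultimately have AY: "A0 * Y = (of_nat p powi N) \<cdot>\<^sub>m (Y * T)"
    using X PQ(1) A1(1) unfolding eq 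
    by (simp add: mult_smult_assoc_mat[of _ r r _ r])
  have "col Y j = 0\<^sub>v r" if "j < r" for j
    using that
  proof (induction j rule: less_induct)
    case (less j)
    have Y0: "Y $$ (i, l) = 0" if "l < j" "i < r" for i l
      using less.IH[OF that(1)] that less.prems Y by (metis carrier_matD index_col index_zero_vec(1) less_trans)
    have "(A0 *\<^sub>v col Y j) $ i = ((of_nat p powi N * T $$ (j, j)) \<cdot>\<^sub>v col Y j) $ i" if i: "i < r" for i
    proof -
      have "(A0 *\<^sub>v col Y j) $ i = (A0 * Y) $$ (i, j)" using A0 Y i less.prems by simp
      also have "\<dots> = of_nat p powi N * (Y * T) $$ (i, j)"
        unfolding AY using Y T(1) i less.prems by simp
      also have "(Y * T) $$ (i, j) = (\<Sum>l<r. Y $$ (i, l) * T $$ (l, j))"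
        by (rule mat_mult_nth[OF Y T(1) i less.prems])
      also have "\<dots> = (\<Sum>l<r. if l = j then Y $$ (i, l) * T $$ (l, j) else 0)"
      proof (rule sum.cong)
        fix l assume "l \<in> {..<r}"
        thus "Y $$ (i, l) * T $$ (l, j) = (if l = j then Y $$ (i, l) * T $$ (l, j) else 0)"
          using Y0[OF _ i] upper_triangularD[OF T(2), of j l] T(1) by (cases l j rule: linorder_cases) auto
      qed simp
      also have "\<dots> = Y $$ (i, j) * T $$ (j, j)" using less.prems by simp
      finally show ?thesis using Y i less.prems by simp
    qed
    hence ev: "A0 *\<^sub>v col Y j = (of_nat p powi N * T $$ (j, j)) \<cdot>\<^sub>v col Y j"
      using A0 Y by (intro eq_vecI) auto
    show ?case
    proof (rule ccontr)
      assume "col Y j \<noteq> 0\<^sub>v r"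
      hence e0: "eigenvalue A0 (of_nat p powi N * T $$ (j, j))"
        unfolding eigenvalue_def eigenvector_def using ev A0 Y by (intro exI[of _ "col Y j"]) auto
      have "T $$ (j, j) \<in> set (diag_mat T)" using T(1) less.prems by (auto simp: diag_mat_def)
      hence "poly (char_poly T) (T $$ (j, j)) = 0"
        by (auto simp: char_poly_upper_triangular[OF T(1,2)] poly_prod_list prod_list_zero_iff)
      hence e1: "eigenvalue A1 (T $$ (j, j))"
        using eigenvalue_root_char_poly[OF A1(1)] char_poly_similar[OF T(3)] by simp
      have "N = 0"
        using restricted_ratio[OF p _ _ _ _ refl] e0 e1 A0(2) A1(2) unfolding p_restricted_def by blast
      thus False using N by simp
    qed
  qed
  hence "Y = 0\<^sub>m r r"
    using Y by (intro eq_matI) (auto, metis carrier_matD index_col index_zero_vec(1))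
  moreover have "X = Y * Q"
    using X PQ by (simp add: Y_def assoc_mult_mat[of _ r r _ r _ r])
  ultimately show ?thesis using PQ(2) by simp
qed

lemma fls_of_bounded_below:
  fixes f :: "int \<Rightarrow> 'a::zero"
  assumes "\<And>N. N < L \<Longrightarrow> f N = 0"
  obtains F where "\<And>N. F $\<^sub>z N = f N"
  using assms by (metis nth_Abs_fls_lower_bound)

text \<open>This is the off-diagonal part of a block triangular gauge equation. At exponent N the
  unknown row is multiplied by x - p^(-N) D, whose singularity would make p^N x an eigenvalue of D.
  Only N = 0 can be resonant, and there the constants \<open>c\<close> absorb the right-hand
  side.\<close>

lemma row_equation:
  assumes p: "p \<ge> 2" and x: "1 \<le> cmod x" "cmod x < real p"
    and D: "D \<in> carrier_mat n n" "p_restricted p D"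
  obtains \<xi> c where "\<And>j. j < n \<Longrightarrow> fls_const x * \<xi> j + g j
    = fls_const (c j) + (\<Sum>k<n. fls_subst_div (of_nat p) (\<xi> k) * fls_const (D $$ (k, j)))"
proof -
  define M where "M N = x \<cdot>\<^sub>m 1\<^sub>m n - (of_nat p powi (- N)) \<cdot>\<^sub>m D" for N
  have M: "M N \<in> carrier_mat n n" for N using D(1) unfolding M_def by (intro minus_carrier_mat) auto
  have detM: "det (M N) \<noteq> 0" if N: "N \<noteq> 0" for N
  proof
    assume "det (M N) = 0"
    then obtain v where v: "v \<in> carrier_vec n" "v \<noteq> 0\<^sub>v n" "M N *\<^sub>v v = 0\<^sub>v n"
      using det_0_iff_vec_prod_zero[OF M] by blast
    have "D *\<^sub>v v = (of_nat p powi N * x) \<cdot>\<^sub>v v"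
    proof (rule eq_vecI)
      fix i assume "i < dim_vec ((of_nat p powi N * x) \<cdot>\<^sub>v v)"
      hence i: "i < n" using v by simp
      have "0 = (M N *\<^sub>v v) $ i" using v i by simp
      also have "\<dots> = (\<Sum>j<n. (if j = i then x * v $ j else 0) - of_nat p powi (- N) * (D $$ (i, j) * v $ j))"
        using D(1) v(1) i unfolding M_def
        by (simp add: scalar_prod_def atLeast0LessThan) (rule sum.cong, auto simp: algebra_simps)
      also have "\<dots> = x * v $ i - of_nat p powi (- N) * (D *\<^sub>v v) $ i"
        using D(1) v(1) i
        by (simp add: sum_subtractf scalar_prod_def atLeast0LessThan flip: sum_distrib_left)
      finally have "x * v $ i = of_nat p powi (- N) * (D *\<^sub>v v) $ i" by simp
      thus "(D *\<^sub>v v) $ i = ((of_nat p powi N * x) \<cdot>\<^sub>v v) $ i"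
        using p v(1) i by (simp add: power_int_minus field_simps)
    qed (use D v in auto)
    hence "eigenvalue D (of_nat p powi N * x)"
      unfolding eigenvalue_def eigenvector_def using D v by auto
    thus False using restricted_ratio[OF p _ _ x refl] D(2) N unfolding p_restricted_def by blast
  qed
  have "\<exists>V. V \<in> carrier_mat n n \<and> (N \<noteq> 0 \<longrightarrow> V * M N = 1\<^sub>m n)" for N
  proof (cases "N = 0")
    case False
    thus ?thesis using GL_inverse[of "M N" n] M detM[OF False] unfolding GL_iff_det by metis
  qed (auto intro: exI[of _ "1\<^sub>m n"])
  then obtain V where V: "\<And>N. V N \<in> carrier_mat n n" "\<And>N. N \<noteq> 0 \<Longrightarrow> V N * M N = 1\<^sub>m n"
    by metis
  \<comment> \<open>At N = 0 the row \<open>\<xi>\<close> gets coefficient 0, which leaves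
    \<open>c j\<close> equal to the constant coefficient of \<open>g j\<close>.\<close>
  define z where "z j N = (if N = 0 then 0 else - (\<Sum>k<n. g k $\<^sub>z N * V N $$ (k, j)))" for j N
  \<comment> \<open>A lower bound for all subdegrees of the finitely many \<open>g k\<close>, which
    makes the coefficient families \<open>z j\<close> Laurent series.\<close>
  define L where "L = - (\<Sum>k<n. \<bar>fls_subdegree (g k)\<bar>)"
  have "z j N = 0" if "N < L" for j N
  proof -
    have "g k $\<^sub>z N = 0" if "k < n" for k
    proof (rule fls_eq0_below_subdegree)
      have "\<bar>fls_subdegree (g k)\<bar> \<le> (\<Sum>k<n. \<bar>fls_subdegree (g k)\<bar>)"
        using \<open>k < n\<close> by (intro member_le_sum) auto
      thus "N < fls_subdegree (g k)" using \<open>N < L\<close> unfolding L_def by linarith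
    qed
    thus ?thesis by (simp add: z_def)
  qed
  hence "\<exists>F. \<forall>N. F $\<^sub>z N = z j N" for j
    using fls_of_bounded_below[of L "z j"] by metis
  then obtain \<xi> where \<xi>: "\<And>j N. \<xi> j $\<^sub>z N = z j N" by metis
  show thesis
  proof (rule that)
    fix j assume j: "j < n"
    show "fls_const x * \<xi> j + g j = fls_const (g j $\<^sub>z 0)
      + (\<Sum>k<n. fls_subst_div (of_nat p) (\<xi> k) * fls_const (D $$ (k, j)))"
    proof (rule fls_eqI)
      fix N
      have rhs: "(\<Sum>k<n. fls_subst_div (of_nat p) (\<xi> k) * fls_const (D $$ (k, j))) $\<^sub>z N
          = (\<Sum>k<n. of_nat p powi (- N) * z k N * D $$ (k, j))"
        by (simp add: fls_nth_sum fls_subst_div_nth \<xi> mult_ac)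
      show "(fls_const x * \<xi> j + g j) $\<^sub>z N = (fls_const (g j $\<^sub>z 0)
        + (\<Sum>k<n. fls_subst_div (of_nat p) (\<xi> k) * fls_const (D $$ (k, j)))) $\<^sub>z N"
      proof (cases "N = 0")
        case True
        thus ?thesis unfolding fls_plus_nth rhs by (simp add: \<xi> z_def)
      next
        case False
        have VM: "(\<Sum>l<n. V N $$ (k, l) * M N $$ (l, j)) = (if k = j then 1 else 0)" if "k < n" for k
          using mat_mult_nth[OF V(1) M that j, of N N] V(2)[OF False] that j by simp
        have "x * z j N - (\<Sum>k<n. of_nat p powi (- N) * z k N * D $$ (k, j))
            = (\<Sum>l<n. (if l = j then x * z l N else 0) - of_nat p powi (- N) * z l N * D $$ (l, j))"
          using j by (simp add: sum_subtractf)
        also have "\<dots> = (\<Sum>l<n. z l N * M N $$ (l, j))"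
          using j D(1) by (intro sum.cong) (auto simp: M_def algebra_simps)
        also have "\<dots> = - (\<Sum>k<n. g k $\<^sub>z N * (\<Sum>l<n. V N $$ (k, l) * M N $$ (l, j)))"
          using False unfolding z_def sum_distrib_left
          by (subst sum.swap) (simp add: sum_negf sum_distrib_right mult.assoc)
        also have "\<dots> = - (\<Sum>k<n. if k = j then g k $\<^sub>z N else 0)"
          by (intro arg_cong[of _ _ uminus] sum.cong) (auto simp: VM)
        also have "\<dots> = - g j $\<^sub>z N" using j by simp
        finally show ?thesis unfolding fls_plus_nth rhs using False by (simp add: \<xi> algebra_simps)
      qed
    qed
  qed
qed

subsection \<open>Reduction to constant form\<close>

lemma mat_subst_div_carrier [simp]: "mat_subst_div c M \<in> carrier_mat r n \<longleftrightarrow> M \<in> carrier_mat r n"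
  by (auto simp: mat_subst_div_def)

lemma const_mat_carrier [simp]: "const_mat M \<in> carrier_mat r n \<longleftrightarrow> M \<in> carrier_mat r n"
  by (auto simp: const_mat_def)

lemma mat_subst_div_mult:
  assumes "c > 0" "M \<in> carrier_mat r n" "N \<in> carrier_mat n k"
  shows "mat_subst_div c (M * N) = mat_subst_div c M * mat_subst_div c N"
proof (rule eq_matI)
  fix i j assume "i < dim_row (mat_subst_div c M * mat_subst_div c N)"
    "j < dim_col (mat_subst_div c M * mat_subst_div c N)"
  hence ij: "i < r" "j < k" using assms by (auto simp: mat_subst_div_def)
  show "mat_subst_div c (M * N) $$ (i, j) = (mat_subst_div c M * mat_subst_div c N) $$ (i, j)"
    using assms ij mat_mult_nth[OF assms(2,3) ij]
      mat_mult_nth[of "mat_subst_div c M" r n "mat_subst_div c N" k i j]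
    by (simp add: mat_subst_div_def fls_subst_div_sum fls_subst_div_mult del: index_mult_mat(1))
qed (use assms in \<open>auto simp: mat_subst_div_def\<close>)

lemma mat_subst_div_commute:
  "mat_subst_div c (mat_subst_div d M) = mat_subst_div d (mat_subst_div c M)"
  by (rule eq_matI) (auto simp: mat_subst_div_def fls_subst_div_compose mult.commute)

lemma mat_subst_div_one [simp]: "mat_subst_div c (1\<^sub>m r) = 1\<^sub>m r"
  by (rule eq_matI) (auto simp: mat_subst_div_def)

lemma mat_subst_div_const_mat [simp]: "mat_subst_div c (const_mat M) = const_mat M"
  by (rule eq_matI) (auto simp: mat_subst_div_def const_mat_def)

lemma GL_intro:
  fixes M N :: "'a::field mat"
  assumes "M \<in> carrier_mat r r" "N \<in> carrier_mat r r" "M * N = 1\<^sub>m r"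
  shows "M \<in> GL r"
proof -
  have "det M * det N = 1" using det_mult[OF assms(1,2)] assms(3) by simp
  thus ?thesis using assms(1) by (auto simp: GL_iff_det)
qed

lemma GL_mult:
  fixes M N :: "'a::field mat"
  assumes "M \<in> GL r" "N \<in> GL r"
  shows "M * N \<in> GL r"
  using assms det_mult[of M r N] by (auto simp: GL_iff_det)

lemma GL_mat_subst_div:
  assumes "c > 0" "M \<in> GL r"
  shows "mat_subst_div c M \<in> GL r"
proof -
  have M: "M \<in> carrier_mat r r" using assms(2) by (simp add: GL_iff_det)
  obtain N where N: "N \<in> carrier_mat r r" "M * N = 1\<^sub>m r" using GL_inverse[OF assms(2)] by metis
  show ?thesis
    by (rule GL_intro[of _ _ "mat_subst_div c N"])
      (use M N in \<open>simp_all flip: mat_subst_div_mult[OF assms(1) M N(1)]\<close>)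
qed

lemma GL_cancel_left:
  fixes S X Y :: "'a::field mat"
  assumes "S \<in> GL r" "X \<in> carrier_mat r n" "Y \<in> carrier_mat r n" "S * X = S * Y"
  shows "X = Y"
proof -
  have S: "S \<in> carrier_mat r r" using assms(1) by (simp add: GL_iff_det)
  obtain N where N: "N \<in> carrier_mat r r" "N * S = 1\<^sub>m r" using GL_inverse[OF assms(1)] by metis
  have "N * (S * X) = N * (S * Y)" using assms(4) by simp
  thus ?thesis using assms(2,3) S N by (simp flip: assoc_mult_mat[of _ r r _ r _ n])
qed

lemma GL_solve_left:
  fixes S Y :: "'a::field mat"
  assumes "S \<in> GL r" "Y \<in> carrier_mat r n"
  obtains X where "X \<in> carrier_mat r n" "S * X = Y"
proof -
  have S: "S \<in> carrier_mat r r" using assms(1) by (simp add: GL_iff_det)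
  obtain N where N: "N \<in> carrier_mat r r" "S * N = 1\<^sub>m r" using GL_inverse[OF assms(1)] by metis
  show thesis
    by (rule that[of "N * Y"]) (use N S assms(2) in \<open>simp_all flip: assoc_mult_mat[of _ r r _ r _ n]\<close>)
qed

text \<open>Since the gauge action is written without inverses, the two sides are compared after
  left multiplication by C(z/(pq)), which is invertible and can be cancelled.\<close>

lemma gauge_consistent:
  assumes pq: "p > 0" "q > 0" and AB: "consistent_pair p q r A B" and C: "C \<in> GL r"
    and A': "A' \<in> carrier_mat r r" "mat_subst_div p C * A' = A * C"
    and B': "B' \<in> carrier_mat r r" "mat_subst_div q C * B' = B * C"
  shows "consistent_pair p q r A' B'"
proof -
  let ?p = "mat_subst_div p" and ?q = "mat_subst_div q"
  have car: "A \<in> carrier_mat r r" "B \<in> carrier_mat r r" "C \<in> carrier_mat r r"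
    and GL: "A \<in> GL r" "B \<in> GL r" and eq: "?p B * A = ?q A * B"
    using AB C by (auto simp: consistent_pair_def GL_iff_det)
  have inGL: "M' \<in> GL r" if "mat_subst_div c C * M' = M * C" "M \<in> GL r" "M' \<in> carrier_mat r r" "c > 0"
    for c M M'
  proof -
    have "M * C \<in> GL r" by (rule GL_mult[OF that(2) C])
    hence "det (mat_subst_div c C) * det M' \<noteq> 0"
      using det_mult[of "mat_subst_div c C" r M'] that car by (simp add: GL_iff_det)
    thus ?thesis using that(3) by (simp add: GL_iff_det)
  qed
  have assoc: "X * Y * Z = X * (Y * Z)"
    if "X \<in> carrier_mat r r" "Y \<in> carrier_mat r r" "Z \<in> carrier_mat r r" for X Y Z :: "complex fls mat"
    using that by (rule assoc_mult_mat)
  let ?S = "?q (?p C)"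
  have "?S * (?p B' * A') = ?p (?q C * B') * A'"
    using A'(1) B'(1) car
    by (simp add: assoc mat_subst_div_mult[OF pq(1), of _ r r _ r] mat_subst_div_commute[of p q])
  also have "\<dots> = ?p B * (?p C * A')"
    unfolding B'(2) using A'(1) car by (simp add: assoc mat_subst_div_mult[OF pq(1), of _ r r _ r])
  also have "\<dots> = (?p B * A) * C" unfolding A'(2) using car by (simp add: assoc)
  also have "\<dots> = ?q A * (?q C * B')" unfolding eq B'(2) using car by (simp add: assoc)
  also have "\<dots> = ?q (A * C) * B'"
    using B'(1) car by (simp add: assoc mat_subst_div_mult[OF pq(2), of _ r r _ r])
  also have "\<dots> = ?S * (?q A' * B')"
    unfolding A'(2)[symmetric] using A'(1) B'(1) car
    by (simp add: assoc mat_subst_div_mult[OF pq(2), of _ r r _ r])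
  finally have "?S * (?p B' * A') = ?S * (?q A' * B')" .
  moreover have "?S \<in> GL r" using GL_mat_subst_div pq C by blast
  moreover have "?p B' * A' \<in> carrier_mat r r" "?q A' * B' \<in> carrier_mat r r"
    using A'(1) B'(1) by (auto intro!: mult_carrier_mat[of _ r r])
  ultimately have "?p B' * A' = ?q A' * B'" using GL_cancel_left by blast
  thus ?thesis unfolding consistent_pair_def using inGL A' B' GL pq by blast
qed

lemma complete_to_GL:
  fixes w :: "nat \<Rightarrow> 'a::field"
  assumes "i0 < r" "w i0 \<noteq> 0"
  obtains C where "C \<in> GL r" "\<And>i. i < r \<Longrightarrow> C $$ (i, 0) = w i"
proof -
  \<comment> \<open>Behind the column w stand all standard basis vectors except the one with index
    \<open>i0\<close>: column \<open>i0\<close>, if it is not column 0, receives basis vector 0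
    instead.\<close>
  define t where "t j = (if j = i0 then 0 else j)" for j :: nat
  define C where "C = mat r r (\<lambda>(i, j). if j = 0 then w i else if i = t j then 1 else 0)"
  have C: "C \<in> carrier_mat r r" by (simp add: C_def)
  have "det C \<noteq> 0"
  proof
    assume "det C = 0"
    then obtain v where v: "v \<in> carrier_vec r" "v \<noteq> 0\<^sub>v r" "C *\<^sub>v v = 0\<^sub>v r"
      using det_0_iff_vec_prod_zero[OF C] by blast
    have row: "(\<Sum>j<r. (if j = 0 then w i else if i = t j then 1 else 0) * v $ j) = 0" if "i < r" for i
    proof -
      have "(C *\<^sub>v v) $ i = 0" using v that by simp
      thus ?thesis using that v(1) by (simp add: C_def scalar_prod_def atLeast0LessThan)
    qed
    have "(\<Sum>j<r. (if j = 0 then w i0 else if i0 = t j then 1 else 0) * v $ j)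
        = (\<Sum>j<r. if j = 0 then w i0 * v $ j else 0)"
      by (rule sum.cong) (auto simp: t_def)
    hence v0: "v $ 0 = 0" using row[OF assms(1)] assms by simp
    have "v $ k = 0" if "k < r" for k
    proof (cases "k = 0")
      case False
      have "(\<Sum>j<r. (if j = 0 then w (t k) else if t k = t j then 1 else 0) * v $ j)
          = (\<Sum>j<r. if j = k then v $ j else 0)"
        by (rule sum.cong) (use False v0 in \<open>auto simp: t_def\<close>)
      thus ?thesis using row[of "t k"] that assms(1) by (simp add: t_def split: if_splits)
    qed (simp add: v0)
    hence "v = 0\<^sub>v r" using v(1) by (intro eq_vecI) auto
    thus False using v(2) by simp
  qed
  thus thesis using that[of C] C assms(1) by (simp add: GL_iff_det C_def)
qed

section \<open>Block triangular matrices with a one-dimensional first block\<close>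

definition bordered :: "nat \<Rightarrow> 'a::zero \<Rightarrow> (nat \<Rightarrow> 'a) \<Rightarrow> 'a mat \<Rightarrow> 'a mat" where
  "bordered n x u D = mat (Suc n) (Suc n)
     (\<lambda>(i, j). if j = 0 then (if i = 0 then x else 0) else if i = 0 then u (j - 1) else D $$ (i - 1, j - 1))"

lemma bordered_carrier [simp]: "bordered n x u D \<in> carrier_mat (Suc n) (Suc n)"
  by (simp add: bordered_def)

lemma bordered_cong:
  assumes "x = x'" "\<And>j. j < n \<Longrightarrow> u j = u' j" "D = D'"
  shows "bordered n x u D = bordered n x' u' D'"
  by (rule eq_matI) (use assms in \<open>auto simp: bordered_def\<close>)

lemma bordered_eqD:
  assumes "bordered n x u D = bordered n x' u' D'" "D \<in> carrier_mat n n" "D' \<in> carrier_mat n n"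
  shows "D = D'"
proof (rule eq_matI)
  fix i j assume "i < dim_row D'" "j < dim_col D'"
  thus "D $$ (i, j) = D' $$ (i, j)"
    using arg_cong[OF assms(1), of "\<lambda>M. M $$ (Suc i, Suc j)"] assms(3) by (simp add: bordered_def)
qed (use assms in auto)

lemma bordered_mult:
  assumes "D \<in> carrier_mat n n" "D' \<in> carrier_mat n n"
  shows "bordered n x u D * bordered n x' u' D'
    = bordered n (x * x') (\<lambda>j. x * u' j + (\<Sum>k<n. u k * D' $$ (k, j))) (D * D')"
    (is "?L = ?R")
proof (rule eq_matI)
  fix i j assume "i < dim_row ?R" "j < dim_col ?R"
  hence ij: "i < Suc n" "j < Suc n" by (auto simp: bordered_def)
  show "?L $$ (i, j) = ?R $$ (i, j)"
    unfolding mat_mult_nth[OF bordered_carrier bordered_carrier ij] sum.lessThan_Suc_shift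
    using ij assms mat_mult_nth[OF assms, of "i - 1" "j - 1"]
    by (simp add: bordered_def del: index_mult_mat)
qed (auto simp: bordered_def)

lemma map_bordered:
  assumes "f 0 = 0" "D \<in> carrier_mat n n"
  shows "map_mat f (bordered n x u D) = bordered n (f x) (\<lambda>j. f (u j)) (map_mat f D)"
  by (rule eq_matI) (use assms in \<open>auto simp: bordered_def\<close>)

lemma det_bordered:
  fixes D :: "'a::idom mat"
  assumes "D \<in> carrier_mat n n"
  shows "det (bordered n x u D) = x * det D"
proof -
  have "bordered n x u D = four_block_mat (mat 1 1 (\<lambda>_. x)) (mat 1 n (\<lambda>(_, j). u j)) (0\<^sub>m n 1) D"
    by (rule eq_matI) (use assms in \<open>auto simp: bordered_def\<close>)
  hence "det (bordered n x u D) = det (mat 1 1 (\<lambda>_. x)) * det D"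
    using det_four_block_mat_lower_left_zero_col[of "mat 1 1 (\<lambda>_. x)" "mat 1 n (\<lambda>(_, j). u j)" n "0\<^sub>m n 1" D]
      assms by simp
  also have "det (mat 1 1 (\<lambda>_. x)) = x" by (subst det_single) auto
  finally show ?thesis .
qed

text \<open>The characteristic matrix is again bordered, so its determinant factors.\<close>

lemma eigenvalue_bordered:
  fixes D :: "'a::field mat"
  assumes D: "D \<in> carrier_mat n n" and ev: "eigenvalue (bordered n x u D) e"
  shows "e = x \<or> eigenvalue D e"
proof -
  have "char_matrix (bordered n x u D) e = bordered n (x - e) u (char_matrix D e)"
    by (rule eq_matI) (use D in \<open>auto simp: bordered_def char_matrix_def\<close>)
  hence "(x - e) * det (char_matrix D e) = 0"
    using ev D eigenvalue_det[OF bordered_carrier, of n x u D e] det_bordered[of "char_matrix D e" n "x - e" u]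
    by simp
  thus ?thesis using eigenvalue_det[OF D] by auto
qed

lemma bordered_of_column:
  assumes "M \<in> carrier_mat (Suc n) (Suc n)" "\<And>i. i < Suc n \<Longrightarrow> M $$ (i, 0) = (if i = 0 then x else 0)"
  shows "M = bordered n x (\<lambda>j. M $$ (0, Suc j)) (mat n n (\<lambda>(i, j). M $$ (Suc i, Suc j)))"
  by (rule eq_matI) (use assms in \<open>auto simp: bordered_def\<close>)

text \<open>Column 0 of \<open>M * C\<close> is x times column 0 of C(z/c), and multiplying by the
  inverse of C(z/c) sends the latter to the first basis vector.\<close>

lemma gauge_eigenvector:
  assumes c: "c > 0" and M: "M \<in> carrier_mat r r" and C: "C \<in> GL r" and r: "r > 0"
    and eig: "\<And>i. i < r \<Longrightarrow> (\<Sum>j<r. M $$ (i, j) * C $$ (j, 0)) = x * fls_subst_div (of_nat c) (C $$ (i, 0))"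
  obtains M' where "M' \<in> carrier_mat r r" "mat_subst_div c C * M' = M * C"
    "\<And>i. i < r \<Longrightarrow> M' $$ (i, 0) = (if i = 0 then x else 0)"
proof -
  have C': "C \<in> carrier_mat r r" using C by (simp add: GL_iff_det)
  obtain N where N: "N \<in> carrier_mat r r" "N * mat_subst_div c C = 1\<^sub>m r" "mat_subst_div c C * N = 1\<^sub>m r"
    using GL_inverse[OF GL_mat_subst_div[OF c C]] by metis
  show thesis
  proof (rule that)
    show "N * (M * C) \<in> carrier_mat r r" using N M C' by simp
    have "mat_subst_div c C * (N * (M * C)) = (mat_subst_div c C * N) * (M * C)"
      using N(1) M C' by (intro assoc_mult_mat[symmetric, of _ r r _ r _ r]) simp_all
    thus "mat_subst_div c C * (N * (M * C)) = M * C"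
      using N(3) M C' by simp
    fix i assume i: "i < r"
    have "(N * (M * C)) $$ (i, 0) = (\<Sum>k<r. N $$ (i, k) * (M * C) $$ (k, 0))"
      using N(1) M C' i r by (intro mat_mult_nth) auto
    also have "\<dots> = (\<Sum>k<r. N $$ (i, k) * (x * mat_subst_div c C $$ (k, 0)))"
    proof (rule sum.cong)
      fix k assume "k \<in> {..<r}"
      hence "(M * C) $$ (k, 0) = x * mat_subst_div c C $$ (k, 0)"
        using mat_mult_nth[OF M C', of k 0] r eig[of k] C' by (simp add: mat_subst_div_def del: index_mult_mat)
      thus "N $$ (i, k) * (M * C) $$ (k, 0) = N $$ (i, k) * (x * mat_subst_div c C $$ (k, 0))" by simp
    qed simp
    also have "\<dots> = x * (N * mat_subst_div c C) $$ (i, 0)"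
      using mat_mult_nth[of N r r "mat_subst_div c C" r i 0] N(1) C' i r
      by (simp add: sum_distrib_left mult_ac del: index_mult_mat)
    also have "\<dots> = (if i = 0 then x else 0)" using N(2) i r by simp
    finally show "(N * (M * C)) $$ (i, 0) = (if i = 0 then x else 0)" .
  qed
qed

text \<open>Only A is normalised here. B takes part in the induction because the common eigenvector
  makes both matrices block triangular, so the lower right blocks form a consistent pair
  again.\<close>

lemma constant_form:
  assumes pq: "p \<ge> 2" "q \<ge> 2" "mult_independent p q" and "consistent_pair p q r A B"
  shows "\<exists>C A0. C \<in> GL r \<and> A0 \<in> carrier_mat r r \<and> p_restricted p A0
    \<and> mat_subst_div p C * const_mat A0 = A * C"
  using assms(4)
proof (induction r arbitrary: A B)
  case 0
  hence A: "A \<in> carrier_mat 0 0" by (auto simp: consistent_pair_def GL_iff_det)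
  have "p_restricted p (1\<^sub>m 0)"
    by (auto simp: p_restricted_def eigenvalue_def eigenvector_def)
  moreover have "(1\<^sub>m 0 :: complex fls mat) \<in> GL 0" by (simp add: GL_iff_det)
  moreover have "mat_subst_div p (1\<^sub>m 0) * const_mat (1\<^sub>m 0) = A * 1\<^sub>m 0"
    by (rule eq_matI) (use A in \<open>auto simp: const_mat_def\<close>)
  ultimately show ?case by (metis one_carrier_mat)
next
  case (Suc n)
  have p: "p > 0" and q: "q > 0" using pq by auto
  have A: "A \<in> carrier_mat (Suc n) (Suc n)" and B: "B \<in> carrier_mat (Suc n) (Suc n)"
    using Suc.prems by (auto simp: consistent_pair_def GL_iff_det)
  obtain x y w where x: "1 \<le> cmod x" "cmod x < real p" and w: "\<exists>i<Suc n. w i \<noteq> 0"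
    "\<And>i. i < Suc n \<Longrightarrow> (\<Sum>j<Suc n. A $$ (i, j) * w j) = fls_const x * fls_subst_div (of_nat p) (w i)"
    "\<And>i. i < Suc n \<Longrightarrow> (\<Sum>j<Suc n. B $$ (i, j) * w j) = fls_const y * fls_subst_div (of_nat q) (w i)"
    using common_eigenvector_pair[OF pq zero_less_Suc Suc.prems] by blast
  from w(1) obtain i0 where "i0 < Suc n" "w i0 \<noteq> 0" by blast
  then obtain C1 where C1: "C1 \<in> GL (Suc n)" "\<And>i. i < Suc n \<Longrightarrow> C1 $$ (i, 0) = w i"
    using complete_to_GL by blast
  have C1': "C1 \<in> carrier_mat (Suc n) (Suc n)" using C1(1) by (simp add: GL_iff_det)
  obtain A1 where A1: "A1 \<in> carrier_mat (Suc n) (Suc n)" "mat_subst_div p C1 * A1 = A * C1"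
    "\<And>i. i < Suc n \<Longrightarrow> A1 $$ (i, 0) = (if i = 0 then fls_const x else 0)"
    by (rule gauge_eigenvector[OF p A C1(1) zero_less_Suc, of "fls_const x"])
      (use w(2) C1(2) in \<open>simp_all del: sum.lessThan_Suc\<close>)
  obtain B1 where B1: "B1 \<in> carrier_mat (Suc n) (Suc n)" "mat_subst_div q C1 * B1 = B * C1"
    "\<And>i. i < Suc n \<Longrightarrow> B1 $$ (i, 0) = (if i = 0 then fls_const y else 0)"
    by (rule gauge_eigenvector[OF q B C1(1) zero_less_Suc, of "fls_const y"])
      (use w(3) C1(2) in \<open>simp_all del: sum.lessThan_Suc\<close>)
  have cons1: "consistent_pair p q (Suc n) A1 B1"
    by (rule gauge_consistent[OF p q Suc.prems C1(1) A1(1,2) B1(1,2)])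
  define u where "u j = A1 $$ (0, Suc j)" for j
  define u' where "u' j = B1 $$ (0, Suc j)" for j
  define D where "D = mat n n (\<lambda>(i, j). A1 $$ (Suc i, Suc j))"
  define E where "E = mat n n (\<lambda>(i, j). B1 $$ (Suc i, Suc j))"
  have DE: "D \<in> carrier_mat n n" "E \<in> carrier_mat n n" by (simp_all add: D_def E_def)
  have A1_eq: "A1 = bordered n (fls_const x) u D"
    unfolding u_def[abs_def] D_def by (rule bordered_of_column[OF A1(1,3)])
  have B1_eq: "B1 = bordered n (fls_const y) u' E"
    unfolding u'_def[abs_def] E_def by (rule bordered_of_column[OF B1(1,3)])
  have subst: "mat_subst_div c (bordered n z v M)
      = bordered n (fls_subst_div (of_nat c) z) (\<lambda>j. fls_subst_div (of_nat c) (v j)) (mat_subst_div c M)"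
    if "M \<in> carrier_mat n n" for c z v M
    unfolding mat_subst_div_def by (rule map_bordered[OF _ that]) simp
  have "mat_subst_div p E * D = mat_subst_div q D * E"
  proof -
    have eq: "mat_subst_div p B1 * A1 = mat_subst_div q A1 * B1"
      using cons1 by (simp add: consistent_pair_def)
    have sub: "mat_subst_div p E \<in> carrier_mat n n" "mat_subst_div q D \<in> carrier_mat n n"
      using DE by simp_all
    show ?thesis
      by (rule bordered_eqD[OF eq[unfolded A1_eq B1_eq, unfolded subst[OF DE(1)] subst[OF DE(2)],
              unfolded bordered_mult[OF sub(1) DE(1)] bordered_mult[OF sub(2) DE(2)]]])
        (use DE in simp_all)
  qed
  moreover have "D \<in> GL n" "E \<in> GL n"
    using cons1 DE unfolding consistent_pair_def GL_iff_det A1_eq B1_eq by (auto simp: det_bordered)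
  ultimately have "consistent_pair p q n D E" by (simp add: consistent_pair_def)
  then obtain C2 D0 where C2: "C2 \<in> GL n" and D0: "D0 \<in> carrier_mat n n" "p_restricted p D0"
    and IH: "mat_subst_div p C2 * const_mat D0 = D * C2" using Suc.IH by blast
  have C2': "C2 \<in> carrier_mat n n" using C2 by (simp add: GL_iff_det)
  obtain \<xi> d where \<xi>: "\<And>j. j < n \<Longrightarrow> fls_const x * \<xi> j + (\<Sum>k<n. u k * C2 $$ (k, j))
    = fls_const (d j) + (\<Sum>k<n. fls_subst_div (of_nat p) (\<xi> k) * fls_const (D0 $$ (k, j)))"
    by (rule row_equation[OF pq(1) x D0, of "\<lambda>j. \<Sum>k<n. u k * C2 $$ (k, j)"]) blast
  \<comment> \<open>The block \<open>C2\<close> normalises the lower right corner, and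
    \<open>\<xi>\<close> corrects the first row: row 0 of the gauge equation between
    \<open>A1\<close> and \<open>A0\<close> is the equation solved for \<open>\<xi>\<close> and
    \<open>d\<close>.\<close>
  define C3 where "C3 = bordered n 1 \<xi> C2"
  define A0 where "A0 = bordered n x d D0"
  have C3: "C3 \<in> GL (Suc n)" "C3 \<in> carrier_mat (Suc n) (Suc n)"
    using C2 by (auto simp: C3_def GL_iff_det det_bordered)
  have A0: "A0 \<in> carrier_mat (Suc n) (Suc n)" by (simp add: A0_def)
  have const_A0: "const_mat A0 = bordered n (fls_const x) (\<lambda>j. fls_const (d j)) (const_mat D0)"
    unfolding A0_def const_mat_def by (rule map_bordered[OF _ D0(1)]) simp
  have \<xi>': "fls_const x * \<xi> j + (\<Sum>k<n. u k * C2 $$ (k, j))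
      = fls_const (d j) + (\<Sum>k<n. fls_subst_div (of_nat p) (\<xi> k) * const_mat D0 $$ (k, j))" if "j < n" for j
    unfolding \<xi>[OF that] using D0(1) that by (auto simp: const_mat_def intro!: sum.cong)
  have "mat_subst_div p C3 * const_mat A0 = A1 * C3"
    unfolding const_A0 A1_eq unfolding C3_def subst[OF C2'] 
    by (subst (1 2) bordered_mult) (use C2' D0 DE \<xi>' in \<open>auto intro!: bordered_cong simp: IH\<close>)
  hence "mat_subst_div p C1 * (mat_subst_div p C3 * const_mat A0) = mat_subst_div p C1 * (A1 * C3)" by simp
  hence "mat_subst_div p (C1 * C3) * const_mat A0 = mat_subst_div p C1 * A1 * C3"
    using C1' C3(2) A0 A1(1)
    by (simp add: mat_subst_div_mult[OF p C1' C3(2)] assoc_mult_mat[of _ "Suc n" "Suc n" _ "Suc n" _ "Suc n"])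
  hence "mat_subst_div p (C1 * C3) * const_mat A0 = A * (C1 * C3)"
    using A C1' C3(2) by (simp add: A1(2) assoc_mult_mat[of _ "Suc n" "Suc n" _ "Suc n" _ "Suc n"])
  moreover have "C1 * C3 \<in> GL (Suc n)" by (rule GL_mult[OF C1(1) C3(1)])
  moreover have "p_restricted p A0"
    using eigenvalue_bordered[OF D0(1)] x D0(2) unfolding p_restricted_def A0_def by blast
  ultimately show ?case using A0 by blast
qed

section \<open>Coefficient matrices and the constancy of intertwiners\<close>

definition coeff_mat :: "int \<Rightarrow> complex fls mat \<Rightarrow> complex mat" where
  "coeff_mat N M = map_mat (\<lambda>f. f $\<^sub>z N) M"

lemma coeff_mat_carrier [simp]: "coeff_mat N M \<in> carrier_mat r n \<longleftrightarrow> M \<in> carrier_mat r n"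
  by (auto simp: coeff_mat_def)

lemma coeff_mat_const_mat [simp]: "coeff_mat 0 (const_mat M) = M"
  by (rule eq_matI) (auto simp: coeff_mat_def const_mat_def)

lemma coeff_mat_one [simp]: "coeff_mat 0 (1\<^sub>m r) = 1\<^sub>m r"
  by (rule eq_matI) (auto simp: coeff_mat_def)

lemma coeff_mat_const_mult:
  assumes "K \<in> carrier_mat r n" "M \<in> carrier_mat n k"
  shows "coeff_mat N (const_mat K * M) = K * coeff_mat N M"
proof (rule eq_matI)
  fix i j assume "i < dim_row (K * coeff_mat N M)" "j < dim_col (K * coeff_mat N M)"
  hence ij: "i < r" "j < k" using assms by (auto simp: coeff_mat_def)
  show "coeff_mat N (const_mat K * M) $$ (i, j) = (K * coeff_mat N M) $$ (i, j)"
    using assms ij mat_mult_nth[of "const_mat K" r n M k i j] mat_mult_nth[of K r n "coeff_mat N M" k i j]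
    by (simp add: coeff_mat_def const_mat_def fls_nth_sum del: index_mult_mat(1))
qed (use assms in \<open>auto simp: coeff_mat_def const_mat_def\<close>)

lemma coeff_mat_mult_const:
  assumes "M \<in> carrier_mat r n" "K \<in> carrier_mat n k"
  shows "coeff_mat N (mat_subst_div c M * const_mat K) = (of_nat c powi (- N)) \<cdot>\<^sub>m (coeff_mat N M * K)"
proof (rule eq_matI)
  fix i j assume "i < dim_row ((of_nat c powi (- N)) \<cdot>\<^sub>m (coeff_mat N M * K))"
    "j < dim_col ((of_nat c powi (- N)) \<cdot>\<^sub>m (coeff_mat N M * K))"
  hence ij: "i < r" "j < k" using assms by (auto simp: coeff_mat_def)
  show "coeff_mat N (mat_subst_div c M * const_mat K) $$ (i, j)
      = ((of_nat c powi (- N)) \<cdot>\<^sub>m (coeff_mat N M * K)) $$ (i, j)"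
    using assms ij mat_mult_nth[of "mat_subst_div c M" r n "const_mat K" k i j]
      mat_mult_nth[of "coeff_mat N M" r n K k i j]
    by (simp add: coeff_mat_def const_mat_def mat_subst_div_def fls_nth_sum fls_subst_div_nth
        sum_distrib_left mult_ac del: index_mult_mat(1))
qed (use assms in \<open>auto simp: coeff_mat_def const_mat_def mat_subst_div_def\<close>)

lemma const_mat_commutation:
  assumes "P \<in> carrier_mat r r" "A1 \<in> carrier_mat r r" "A0 \<in> carrier_mat r r"
    and "const_mat P * const_mat A1 = const_mat A0 * const_mat P"
  shows "P * A1 = A0 * P"
  using arg_cong[OF assms(4), of "coeff_mat 0"] assms(1-3)
  by (simp add: coeff_mat_const_mult[of _ r r _ r])

text \<open>A constant factor acts on each coefficient separately, so the constant coefficient of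
  the inverse is already an inverse.\<close>

lemma const_mat_GL_D:
  assumes "const_mat M \<in> GL r"
  shows "M \<in> GL r"
proof -
  have M: "M \<in> carrier_mat r r" using assms by (simp add: GL_iff_det)
  obtain N where N: "N \<in> carrier_mat r r" "const_mat M * N = 1\<^sub>m r" using GL_inverse[OF assms] by metis
  have "M * coeff_mat 0 N = 1\<^sub>m r"
    using coeff_mat_const_mult[OF M N(1), of 0] by (simp add: N(2))
  thus ?thesis using M N(1) by (intro GL_intro[of M r "coeff_mat 0 N"]) auto
qed

text \<open>The coefficient of C at z^N intertwines A1 and A0 up to the factor p^(-N), so it
  vanishes unless N = 0. With A0 = A1 this treats B, and with two restricted matrices it treats
  gauge transformations.\<close>

lemma restricted_intertwiner_const:
  assumes p: "p \<ge> 2" and A0: "A0 \<in> carrier_mat r r" "p_restricted p A0"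
    and A1: "A1 \<in> carrier_mat r r" "p_restricted p A1"
    and C: "C \<in> carrier_mat r r" "mat_subst_div p C * const_mat A1 = const_mat A0 * C"
  shows "C = const_mat (coeff_mat 0 C)"
proof -
  have zero: "coeff_mat N C = 0\<^sub>m r r" if "N \<noteq> 0" for N
  proof (rule restricted_intertwiner_zero[OF p A0 A1])
    show "A0 * coeff_mat N C = (of_nat p powi (- N)) \<cdot>\<^sub>m (coeff_mat N C * A1)"
      using arg_cong[OF C(2), of "coeff_mat N"]
      by (simp only: coeff_mat_mult_const[OF C(1) A1(1)] coeff_mat_const_mult[OF A0(1) C(1)])
  qed (use C that in auto)
  show ?thesis
  proof (rule eq_matI)
    fix i j assume "i < dim_row (const_mat (coeff_mat 0 C))" "j < dim_col (const_mat (coeff_mat 0 C))"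
    hence ij: "i < dim_row C" "j < dim_col C" by (auto simp: const_mat_def coeff_mat_def)
    have "C $$ (i, j) $\<^sub>z N = 0" if "N \<noteq> 0" for N
      using arg_cong[OF zero[OF that], of "\<lambda>M. M $$ (i, j)"] ij C(1) by (simp add: coeff_mat_def)
    thus "C $$ (i, j) = const_mat (coeff_mat 0 C) $$ (i, j)"
      using ij by (auto simp: const_mat_def coeff_mat_def intro!: fls_eqI)
  qed (auto simp: const_mat_def coeff_mat_def)
qed

theorem theorem4p3:
  fixes p q r :: nat
  assumes "p \<ge> 2" and "q \<ge> 2" and "mult_independent p q"
  shows "(\<forall>A B. consistent_pair p q r A B \<longrightarrow>
            (\<exists>A0 B0. scalar_hom r A0 B0 \<and> p_restricted p A0 \<and>
                     gauge_equiv p q r A B (const_mat A0) (const_mat B0)))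
       \<and> (\<forall>A0 B0 A1 B1. scalar_hom r A0 B0 \<and> p_restricted p A0 \<and>
                       scalar_hom r A1 B1 \<and> p_restricted p A1 \<and>
                       gauge_equiv p q r (const_mat A0) (const_mat B0) (const_mat A1) (const_mat B1)
                   \<longrightarrow> conj_equiv r A0 B0 A1 B1)"
proof (intro conjI allI impI)
  fix A B assume AB: "consistent_pair p q r A B"
  have p: "p > 0" and q: "q > 0" using assms by auto
  have B: "B \<in> carrier_mat r r" using AB by (auto simp: consistent_pair_def GL_iff_det)
  obtain C A0 where C: "C \<in> GL r" and A0: "A0 \<in> carrier_mat r r" "p_restricted p A0"
    and CA: "mat_subst_div p C * const_mat A0 = A * C"
    using constant_form[OF assms AB] by blast
  have C': "C \<in> carrier_mat r r" using C by (simp add: GL_iff_det)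
  have "B * C \<in> carrier_mat r r" using B C' by simp
  then obtain B' where B': "B' \<in> carrier_mat r r" and CB: "mat_subst_div q C * B' = B * C"
    using GL_solve_left[OF GL_mat_subst_div[OF q C]] by metis
  have cons: "consistent_pair p q r (const_mat A0) B'"
    using gauge_consistent[OF p q AB C _ CA B' CB] A0(1) by simp
  \<comment> \<open>Substitution fixes the constant matrix, so consistency now says that
    \<open>B'\<close> intertwines A0 with itself.\<close>
  hence comm: "mat_subst_div p B' * const_mat A0 = const_mat A0 * B'"
    and GL: "const_mat A0 \<in> GL r" "B' \<in> GL r" by (simp_all add: consistent_pair_def)
  define B0 where "B0 = coeff_mat 0 B'"
  have B'_eq: "B' = const_mat B0"
    unfolding B0_def by (rule restricted_intertwiner_const[OF assms(1) A0 A0 B' comm])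
  have B0: "B0 \<in> carrier_mat r r" using B' by (simp add: B0_def)
  have "B0 * A0 = A0 * B0"
    by (rule const_mat_commutation[OF B0 A0(1) A0(1)]) (use comm in \<open>simp add: B'_eq\<close>)
  hence "scalar_hom r A0 B0"
    using GL const_mat_GL_D unfolding scalar_hom_def B'_eq by auto
  moreover have "gauge_equiv p q r A B (const_mat A0) (const_mat B0)"
    unfolding gauge_equiv_def using C CA CB B'_eq by blast
  ultimately show "\<exists>A0 B0. scalar_hom r A0 B0 \<and> p_restricted p A0 \<and>
      gauge_equiv p q r A B (const_mat A0) (const_mat B0)" using A0(2) by blast
next
  fix A0 B0 A1 B1
  assume *: "scalar_hom r A0 B0 \<and> p_restricted p A0 \<and> scalar_hom r A1 B1 \<and> p_restricted p A1 \<and>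
    gauge_equiv p q r (const_mat A0) (const_mat B0) (const_mat A1) (const_mat B1)"
  then obtain C where C: "C \<in> GL r" "mat_subst_div p C * const_mat A1 = const_mat A0 * C"
    "mat_subst_div q C * const_mat B1 = const_mat B0 * C" unfolding gauge_equiv_def by blast
  have car: "A0 \<in> carrier_mat r r" "B0 \<in> carrier_mat r r" "A1 \<in> carrier_mat r r" "B1 \<in> carrier_mat r r"
    using * by (auto simp: scalar_hom_def GL_def)
  have C': "C \<in> carrier_mat r r" using C(1) by (simp add: GL_iff_det)
  define P where "P = coeff_mat 0 C"
  \<comment> \<open>The equation for the A-matrices alone makes C constant; the one for the
    B-matrices then becomes an identity of complex matrices.\<close>
  have CP: "C = const_mat P"
    unfolding P_def using * car by (intro restricted_intertwiner_const[OF assms(1) _ _ _ _ C' C(2)]) auto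
  have P: "P \<in> carrier_mat r r" using C' by (simp add: P_def)
  have "P * A1 = A0 * P" "P * B1 = B0 * P"
    using C(2,3) by (auto intro!: const_mat_commutation P car simp: CP)
  moreover have "P \<in> GL r" using C(1) const_mat_GL_D by (simp add: CP)
  ultimately show "conj_equiv r A0 B0 A1 B1" unfolding conj_equiv_def by blast
qed

end
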